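(* Let $n\ge 1$, $p>1$ be integers, $c\in\mathbb R^n$, $A_0,A_1,\dots,A_n$ real symmetric $p\times p$ matrices, $\mathcal A(x)=A_0+\sum_{i=1}^n x_iA_i$, and suppose that the feasible set $X=\{x\in\mathbb R^n:\mathcal A(x)\in\mathcal{COP}^p\}$ of the linear copositive problem $\min\{c^\top x:\ \mathcal A(x)\in\mathcal{COP}^p\}$ is nonempty. Consider the algorithm REG-LCoP defined in the context. Then: (i) The algorithm is well defined: whenever iteration $\#0$ (respectively iteration $\# m$, $m\ge 1$) does not stop, data with the properties required there exist. Moreover, at the beginning of every iteration $\#m$ with $m\ge 1$ that is reached, the current data satisfy, for all $i\in I_m$: $\tau(i)\in T_{im}$, $P_+(\tau(i))\subset L_m(i)\subset P$, and $e_k^\top\mathcal A(x)\tau(i)=0$ for all $k\in L_m(i)$ and all $x\in X$. (ii) For any choice of the data made in the iterations, the algorithm stops after a finite number of iterations, at some iteration $\#m_*$, $m_*\ge 0$. (iii) If $m_*=0$, the copositive problem satisfies the Slater condition: there is $\bar x\in\mathbb R^n$ with $t^\top\mathcal A(\bar x)t>0$ for all $t\in\mathbb R^p_+\setminus\{0\}$. (iv) If $m_*>0$, then, with $W_{m_*}=\{\tau(i):i\in I_{m_*}\}$, the problem $$\begin{aligned}\min_{x\in\mathbb R^n}\ & c^\top x\\ \text{s.t. } & e_k^\top\mathcal A(x)\tau(i)=0\ \ \forall k\in L_{m_*}(i),\quad e_k^\top\mathcal A(x)\tau(i)\ge 0\ \ \forall k\in P\setminus L_{m_*}(i),\quad \forall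 i\in I_{m_*},\\ & t^\top\mathcal A(x)t\ge 0\ \ \forall t\in\Omega(W_{m_*})\end{aligned}$$ is equivalent to the copositive problem (its feasible set is exactly $X$), and there exists $\bar x\in X$ such that $t^\top\mathcal A(\bar x)t>0$ for all $t\in\Omega(W_{m_*})$.
   Context: Notation. $P=\{1,\dots,p\}$; $e_1,\dots,e_p$ is the standard basis of $\mathbb R^p$; $\mathcal{COP}^p=\{D \text{ real symmetric } p\times p:\ t^\top Dt\ge 0\ \forall t\in\mathbb R^p_+\}$ is the cone of copositive matrices; $T=\{t\in\mathbb R^p_+:\sum_{k\in P}t_k=1\}$. For $t\in\mathbb R^p_+$: $P_+(t)=\{k\in P:t_k>0\}$, $P_0(t)=P\setminus P_+(t)$. The set of normalized immobile indices is $T_{im}=\{t\in T:\ t^\top\mathcal A(x)t=0\ \forall x\in X\}$. Index families $(\tau(i))_{i\in I}$ are labelled by finite sets $I$. For a finite nonempty set $V=\{\tau(i):i\in I\}\subset T$ put $\sigma(V)=\min\{\tau_k(i): k\in P_+(\tau(i)),\ i\in I\}>0$ and $\Omega(V)=\{t\in T:\rho(t,\mathrm{conv}\,V)\ge\sigma(V)\}$, where $\rho(l,\mathcal B)=\min_{\tau\in\mathcal B}\sum_{k\in P}|l_k-\tau_k|$. Algorithm REG-LCoP. Iteration $\#0$. Consider the problem $(SIP_0)$: minimize $\mu$ over $(x,\mu)\in\mathbb R^{n+1}$ subject to $t^\top\mathcal A(x)t+\mu\ge 0$ for all $t\in T$. If it has a feasible solution with $\mu<0$, stop with $m_*=0$.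 Otherwise choose a finite nonempty index set $I_1$, $|I_1|\le n+1$, and $\tau(i)\in T$, $\gamma(i)>0$ for $i\in I_1$, such that $\sum_{i\in I_1}\gamma(i)\tau(i)^\top A_j\tau(i)=0$ for $j=0,1,\dots,n$ and $\sum_{i\in I_1}\gamma(i)=1$. Set $L_1(i)=P_+(\tau(i))$, $i\in I_1$, and go to iteration $\#1$. Iteration $\#m$, $m\ge 1$. Given $\tau(i)\in T$ and $L_m(i)\subset P$, $i\in I_m$, set $W_m=\{\tau(i):i\in I_m\}$ and consider the problem $(SIP_m)$: minimize $\mu$ over $(x,\mu)\in\mathbb R^{n+1}$ subject to $e_k^\top\mathcal A(x)\tau(i)=0$ for all $k\in L_m(i)$ and $e_k^\top\mathcal A(x)\tau(i)\ge 0$ for all $k\in P\setminus L_m(i)$, for all $i\in I_m$, and $t^\top\mathcal A(x)t+\mu\ge 0$ for all $t\in\Omega(W_m)$. If it has a feasible solution with $\mu<0$, stop with $m_*=m$. Otherwise choose a finite index set $\Delta I_m$ disjoint from $I_m$ with $1\le|\Delta I_m|\le n+1$, points $\tau(i)\in\Omega(W_m)$ and numbers $\gamma(i)>0$ for $i\in\Delta I_m$, and vectors $\lambda^m(i)\in\mathbb R^p$ for $i\in I_m$, such that $$\sum_{i\in\Delta I_m}\gamma(i)\tau(i)^\top A_j\tau(i)+2\sum_{i\in I_m}\lambda^m(i)^\top A_j\tau(i)=0,\quad j=0,1,\dots,n,$$ $\lambda^m_k(i)\ge 0$ for all $k\in P\setminus L_m(i)$, $i\in I_m$, and $P_0(\tau(i))\cap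 P_+(\tau(j))\neq\emptyset$ for all $i\in\Delta I_m$, $j\in I_m$. Set $\Delta L(i)=\{k\in P\setminus L_m(i):\lambda_k^m(i)>0\}$ and $L_{m+1}(i)=L_m(i)\cup\Delta L(i)$ for $i\in I_m$; $L_{m+1}(i)=P_+(\tau(i))$ for $i\in\Delta I_m$; $I_{m+1}=I_m\cup\Delta I_m$; and go to iteration $\#(m+1)$. *)

theory Defs
  imports "HOL-Analysis.Analysis"
begin

text \<open>
  The index set \<open>P = {1,...,p}\<close> is the universe of the finite type \<open>'p\<close>, and \<open>\<real>\<^sup>n\<close> is
  \<open>real ^ 'n\<close>. The matrix \<open>A\<^sub>0\<close> is kept separate from the family \<open>A\<^sub>j\<close>, \<open>j \<in> 'n\<close>.
\<close>

definition nonneg_orthant :: "(real ^ 'p) set" where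
  "nonneg_orthant = {t. \<forall>k. 0 \<le> t $ k}"

definition std_simplex :: "(real ^ 'p) set" where
  "std_simplex = {t \<in> nonneg_orthant. (\<Sum>k\<in>UNIV. t $ k) = 1}"

definition Ppos :: "real ^ 'p \<Rightarrow> 'p set" where
  "Ppos t = {k. t $ k > 0}"

definition Pzero :: "real ^ 'p \<Rightarrow> 'p set" where
  "Pzero t = UNIV - Ppos t"

definition COP :: "(real ^ 'p ^ 'p) set" where
  "COP = {D. transpose D = D \<and> (\<forall>t\<in>nonneg_orthant. t \<bullet> (D *v t) \<ge> 0)}"

definition pencil :: "real ^ 'p ^ 'p \<Rightarrow> ('n::finite \<Rightarrow> real ^ 'p ^ 'p) \<Rightarrow> real ^ 'n \<Rightarrow> real ^ 'p ^ 'p" where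
  "pencil A0 A x = A0 + (\<Sum>i\<in>UNIV. x $ i *\<^sub>R A i)"

definition feasX :: "real ^ 'p ^ 'p \<Rightarrow> ('n::finite \<Rightarrow> real ^ 'p ^ 'p) \<Rightarrow> (real ^ 'n) set" where
  "feasX A0 A = {x. pencil A0 A x \<in> COP}"

definition immobile :: "real ^ 'p ^ 'p \<Rightarrow> ('n::finite \<Rightarrow> real ^ 'p ^ 'p) \<Rightarrow> (real ^ 'p) set" where
  "immobile A0 A = {t \<in> std_simplex. \<forall>x\<in>feasX A0 A. t \<bullet> (pencil A0 A x *v t) = 0}"

definition slater_condition :: "real ^ 'p ^ 'p \<Rightarrow> ('n::finite \<Rightarrow> real ^ 'p ^ 'p) \<Rightarrow> bool" where
  "slater_condition A0 A \<longleftrightarrow>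
     (\<exists>x. \<forall>t\<in>nonneg_orthant - {0}. t \<bullet> (pencil A0 A x *v t) > 0)"

text \<open>
  The minimum defining \<open>\<rho>\<close> is written as an infimum; it is only used for the nonempty compact
  sets \<open>convex hull V\<close>, where the infimum is attained.
\<close>

definition rho :: "real ^ 'p \<Rightarrow> (real ^ 'p) set \<Rightarrow> real" where
  "rho l B = (INF \<tau>\<in>B. \<Sum>k\<in>UNIV. \<bar>l $ k - \<tau> $ k\<bar>)"

definition sigma :: "(real ^ 'p) set \<Rightarrow> real" where
  "sigma V = Min {\<tau> $ k | \<tau> k. \<tau> \<in> V \<and> k \<in> Ppos \<tau>}"

definition Omega :: "(real ^ 'p) set \<Rightarrow> (real ^ 'p) set" where
  "Omega V = {t \<in> std_simplex. rho t (convex hull V) \<ge> sigma V}"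


text \<open>
  Data at the beginning of iteration \<open>#m\<close>, \<open>m \<ge> 1\<close>: the label set \<open>I\<^sub>m\<close>, the points \<open>\<tau>(i)\<close> and the
  sets \<open>L\<^sub>m(i)\<close>. Labels are natural numbers; values at labels outside \<open>I\<^sub>m\<close> are irrelevant.
\<close>

record ('p::finite) alg_state =
  idx :: "nat set"
  tau :: "nat \<Rightarrow> real ^ 'p"
  Lset :: "nat \<Rightarrow> 'p set"

definition Wset :: "('p::finite) alg_state \<Rightarrow> (real ^ 'p) set" where
  "Wset st = tau st ` idx st"

definition linear_constraints ::
    "real ^ 'p ^ 'p \<Rightarrow> ('n::finite \<Rightarrow> real ^ 'p ^ 'p) \<Rightarrow> ('p::finite) alg_state \<Rightarrow> real ^ 'n \<Rightarrow> bool" where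
  "linear_constraints A0 A st x \<longleftrightarrow>
     (\<forall>i\<in>idx st.
        (\<forall>k\<in>Lset st i. axis k 1 \<bullet> (pencil A0 A x *v tau st i) = 0) \<and>
        (\<forall>k\<in>UNIV - Lset st i. axis k 1 \<bullet> (pencil A0 A x *v tau st i) \<ge> 0))"

definition sip0_feasible ::
    "real ^ 'p ^ 'p \<Rightarrow> ('n::finite \<Rightarrow> real ^ 'p ^ 'p) \<Rightarrow> ((real ^ 'n) \<times> real) set" where
  "sip0_feasible A0 A = {(x, \<mu>). \<forall>t\<in>std_simplex. t \<bullet> (pencil A0 A x *v t) + \<mu> \<ge> 0}"

definition sip_feasible ::
    "real ^ 'p ^ 'p \<Rightarrow> ('n::finite \<Rightarrow> real ^ 'p ^ 'p) \<Rightarrow> ('p::finite) alg_state \<Rightarrow> ((real ^ 'n) \<times> real) set" where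
  "sip_feasible A0 A st = {(x, \<mu>). linear_constraints A0 A st x \<and>
     (\<forall>t\<in>Omega (Wset st). t \<bullet> (pencil A0 A x *v t) + \<mu> \<ge> 0)}"

definition stop_initial :: "real ^ 'p ^ 'p \<Rightarrow> ('n::finite \<Rightarrow> real ^ 'p ^ 'p) \<Rightarrow> bool" where
  "stop_initial A0 A \<longleftrightarrow> (\<exists>(x, \<mu>)\<in>sip0_feasible A0 A. \<mu> < 0)"

definition stop_at :: "real ^ 'p ^ 'p \<Rightarrow> ('n::finite \<Rightarrow> real ^ 'p ^ 'p) \<Rightarrow> ('p::finite) alg_state \<Rightarrow> bool" where
  "stop_at A0 A st \<longleftrightarrow> (\<exists>(x, \<mu>)\<in>sip_feasible A0 A st. \<mu> < 0)"

definition initial_data ::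
    "real ^ 'p ^ 'p \<Rightarrow> ('n::finite \<Rightarrow> real ^ 'p ^ 'p) \<Rightarrow>
     nat set \<Rightarrow> (nat \<Rightarrow> real ^ 'p) \<Rightarrow> (nat \<Rightarrow> real) \<Rightarrow> bool" where
  "initial_data A0 A I \<tau> \<gamma> \<longleftrightarrow>
     finite I \<and> I \<noteq> {} \<and> card I \<le> CARD('n) + 1 \<and>
     (\<forall>i\<in>I. \<tau> i \<in> std_simplex \<and> \<gamma> i > 0) \<and>
     (\<forall>M\<in>insert A0 (range A). (\<Sum>i\<in>I. \<gamma> i * (\<tau> i \<bullet> (M *v \<tau> i))) = 0) \<and>
     (\<Sum>i\<in>I. \<gamma> i) = 1"

definition initial_state :: "nat set \<Rightarrow> (nat \<Rightarrow> real ^ 'p) \<Rightarrow> ('p::finite) alg_state" where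
  "initial_state I \<tau> = \<lparr>idx = I, tau = \<tau>, Lset = (\<lambda>i. Ppos (\<tau> i))\<rparr>"

text \<open>
  The arguments \<open>\<Delta>I\<close>, \<open>\<tau>\<close>, \<open>\<gamma>\<close>, \<open>\<Lambda>\<close> are the choices made in an iteration
  \<open>#m\<close>, \<open>m \<ge> 1\<close>: \<open>\<tau>\<close> and \<open>\<gamma>\<close> matter only on \<open>\<Delta>I\<close>, and \<open>\<Lambda> i\<close> is
  \<open>\<lambda>\<^sup>m(i)\<close> for \<open>i \<in> I\<^sub>m\<close>.
\<close>

definition iteration_data ::
    "real ^ 'p ^ 'p \<Rightarrow> ('n::finite \<Rightarrow> real ^ 'p ^ 'p) \<Rightarrow> ('p::finite) alg_state \<Rightarrow>
     nat set \<Rightarrow> (nat \<Rightarrow> real ^ 'p) \<Rightarrow> (nat \<Rightarrow> real) \<Rightarrow> (nat \<Rightarrow> real ^ 'p) \<Rightarrow> bool" where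
  "iteration_data A0 A st \<Delta>I \<tau> \<gamma> \<Lambda> \<longleftrightarrow>
     finite \<Delta>I \<and> \<Delta>I \<inter> idx st = {} \<and> 1 \<le> card \<Delta>I \<and> card \<Delta>I \<le> CARD('n) + 1 \<and>
     (\<forall>i\<in>\<Delta>I. \<tau> i \<in> Omega (Wset st) \<and> \<gamma> i > 0) \<and>
     (\<forall>M\<in>insert A0 (range A).
        (\<Sum>i\<in>\<Delta>I. \<gamma> i * (\<tau> i \<bullet> (M *v \<tau> i))) +
        2 * (\<Sum>i\<in>idx st. \<Lambda> i \<bullet> (M *v tau st i)) = 0) \<and>
     (\<forall>i\<in>idx st. \<forall>k\<in>UNIV - Lset st i. \<Lambda> i $ k \<ge> 0) \<and>
     (\<forall>i\<in>\<Delta>I. \<forall>j\<in>idx st. Pzero (\<tau> i) \<inter> Ppos (tau st j) \<noteq> {})"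

definition next_state ::
    "('p::finite) alg_state \<Rightarrow> nat set \<Rightarrow> (nat \<Rightarrow> real ^ 'p) \<Rightarrow> (nat \<Rightarrow> real ^ 'p) \<Rightarrow> 'p alg_state" where
  "next_state st \<Delta>I \<tau> \<Lambda> =
     \<lparr>idx = idx st \<union> \<Delta>I,
      tau = (\<lambda>i. if i \<in> \<Delta>I then \<tau> i else tau st i),
      Lset = (\<lambda>i. if i \<in> \<Delta>I then Ppos (\<tau> i)
                   else Lset st i \<union> {k \<in> UNIV - Lset st i. \<Lambda> i $ k > 0})\<rparr>"

text \<open>
  A record of the algorithm is a sequence \<open>S\<close>, where \<open>S m\<close> holds the data at the beginning of
  iteration \<open>#m\<close> for \<open>m \<ge> 1\<close>; \<open>S 0\<close> is unused, and so are the values of \<open>S\<close> after the algorithm has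
  stopped.
\<close>

definition iteration_stops ::
    "real ^ 'p ^ 'p \<Rightarrow> ('n::finite \<Rightarrow> real ^ 'p ^ 'p) \<Rightarrow> (nat \<Rightarrow> ('p::finite) alg_state) \<Rightarrow> nat \<Rightarrow> bool" where
  "iteration_stops A0 A S m \<longleftrightarrow> (if m = 0 then stop_initial A0 A else stop_at A0 A (S m))"

definition iteration_result ::
    "real ^ 'p ^ 'p \<Rightarrow> ('n::finite \<Rightarrow> real ^ 'p ^ 'p) \<Rightarrow> (nat \<Rightarrow> ('p::finite) alg_state) \<Rightarrow> nat \<Rightarrow> bool" where
  "iteration_result A0 A S m \<longleftrightarrow>
     (if m = 0
      then \<exists>I \<tau> \<gamma>. initial_data A0 A I \<tau> \<gamma> \<and> S 1 = initial_state I \<tau>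
      else \<exists>\<Delta>I \<tau> \<gamma> \<Lambda>. iteration_data A0 A (S m) \<Delta>I \<tau> \<gamma> \<Lambda> \<and>
             S (Suc m) = next_state (S m) \<Delta>I \<tau> \<Lambda>)"

text \<open>\<open>reached A0 A S m\<close>: iteration \<open>#m\<close> is reached with the choices recorded in \<open>S\<close>.\<close>

primrec reached ::
    "real ^ 'p ^ 'p \<Rightarrow> ('n::finite \<Rightarrow> real ^ 'p ^ 'p) \<Rightarrow> (nat \<Rightarrow> ('p::finite) alg_state) \<Rightarrow> nat \<Rightarrow> bool" where
  "reached A0 A S 0 \<longleftrightarrow> True"
| "reached A0 A S (Suc m) \<longleftrightarrow>
     reached A0 A S m \<and> \<not> iteration_stops A0 A S m \<and> iteration_result A0 A S m"

text \<open>A complete execution: as long as the algorithm has not stopped, it is continued.\<close>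

definition execution ::
    "real ^ 'p ^ 'p \<Rightarrow> ('n::finite \<Rightarrow> real ^ 'p ^ 'p) \<Rightarrow> (nat \<Rightarrow> ('p::finite) alg_state) \<Rightarrow> bool" where
  "execution A0 A S \<longleftrightarrow>
     (\<forall>m. reached A0 A S m \<and> \<not> iteration_stops A0 A S m \<longrightarrow> iteration_result A0 A S m)"

definition terminates_at ::
    "real ^ 'p ^ 'p \<Rightarrow> ('n::finite \<Rightarrow> real ^ 'p ^ 'p) \<Rightarrow> (nat \<Rightarrow> ('p::finite) alg_state) \<Rightarrow> nat \<Rightarrow> bool" where
  "terminates_at A0 A S m \<longleftrightarrow> reached A0 A S m \<and> iteration_stops A0 A S m"


record 'a opt_problem =
  objective :: "'a \<Rightarrow> real"
  feasible_set :: "'a set"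

definition equivalent_problems :: "'a opt_problem \<Rightarrow> 'a opt_problem \<Rightarrow> bool" where
  "equivalent_problems Q R \<longleftrightarrow> feasible_set Q = feasible_set R \<and>
     (\<forall>x\<in>feasible_set R. objective Q x = objective R x)"

definition copositive_problem ::
    "real ^ 'n \<Rightarrow> real ^ 'p ^ 'p \<Rightarrow> ('n::finite \<Rightarrow> real ^ 'p ^ 'p) \<Rightarrow> (real ^ 'n) opt_problem" where
  "copositive_problem c A0 A = \<lparr>objective = (\<lambda>x. c \<bullet> x), feasible_set = feasX A0 A\<rparr>"

definition regularized_problem ::
    "real ^ 'n \<Rightarrow> real ^ 'p ^ 'p \<Rightarrow> ('n::finite \<Rightarrow> real ^ 'p ^ 'p) \<Rightarrow> ('p::finite) alg_state \<Rightarrow>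
     (real ^ 'n) opt_problem" where
  "regularized_problem c A0 A st =
     \<lparr>objective = (\<lambda>x. c \<bullet> x),
      feasible_set = {x. linear_constraints A0 A st x \<and>
        (\<forall>t\<in>Omega (Wset st). t \<bullet> (pencil A0 A x *v t) \<ge> 0)}\<rparr>"

end

(*
  Pairing a vector y of R^(n+1) with the coefficients of the data equations gives a quadratic form
  whose matrix is y_0 A_0 + ... + y_n A_n, and adding a multiple of (1, x) with x feasible makes
  y_0 positive without spoiling any sign. Hence, by separation from a compact convex set plus a
  finitely generated cone, a stop test fails only if 0 lies in that sum, which is exactly the
  existence of the data; as the points involved are orthogonal to (1, x), Caratheodory's theorem
  is applied in a hyperplane, which gives n + 1 points instead of n + 2.

  If the support of t contains that of some s in W, then t is a convex combination of s and a point
  r of smaller support, r is at least as far from conv W as t, and t^T M t >= (1 - theta)^2 r^T M r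
  whenever M s >= 0. Points of T outside Omega(W) always contain the support of some s in W.
  Induction on the support therefore carries positivity from the points of Omega(W) whose support
  contains none of the old supports to Omega(W), and nonnegativity from Omega(W) to T.
*)

theory Submission
  imports Defs
begin

section \<open>Separation and Caratheodory in a hyperplane\<close>

text \<open>If 0 lies outside the closed convex set \<open>convex hull C\<close> +
  \<open>convex_cone hull F\<close>, a separating normal serves as \<open>y\<close>. Otherwise
  \<open>e\<close> confines the hull part to the hyperplane \<open>e \<bullet> x = 0\<close>, which
  lowers the Caratheodory bound from dimension + 1 to the dimension.\<close>

lemma conic_alternative:
  fixes C F :: "'a::euclidean_space set"
  assumes C: "compact C" "C \<noteq> {}" and F: "finite F" and "e \<noteq> 0"
    and eC: "\<forall>c\<in>C. 0 \<le> e \<bullet> c" and eF: "\<forall>f\<in>F. 0 \<le> e \<bullet> f"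
  shows "(\<exists>y. (\<forall>c\<in>C. 0 < y \<bullet> c) \<and> (\<forall>f\<in>F. 0 \<le> y \<bullet> f)) \<or>
    (\<exists>D u v. finite D \<and> D \<subseteq> C \<and> card D \<le> DIM('a) \<and> (\<forall>d\<in>D. 0 < u d) \<and> sum u D = (1::real) \<and>
      v \<in> convex_cone hull F \<and> (\<Sum>d\<in>D. u d *\<^sub>R d) + v = 0)" (is "?sep \<or> ?comb")
proof -
  let ?N = "convex_cone hull F"
  let ?S = "\<Union>x\<in>convex hull C. \<Union>y\<in>?N. {x + y}"
  show ?thesis
  proof (cases "0 \<in> ?S")
    case False
    have "closed ?N"
      by (simp add: F polyhedron_convex_cone_hull polyhedron_imp_closed)
    then have "closed ?S"
      by (intro compact_closed_sums compact_convex_hull C)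
    moreover have "convex ?S"
      by (intro convex_sums convex_convex_hull convex_convex_cone_hull)
    ultimately obtain y b where b: "0 < b" and y: "\<And>x. x \<in> ?S \<Longrightarrow> b < y \<bullet> x"
      using separating_hyperplane_closed_point[of ?S 0] False by (metis inner_zero_right)
    have pos: "b < y \<bullet> c + s * (y \<bullet> f)" if "c \<in> C" "f \<in> ?N" "0 \<le> s" for c f s
    proof -
      have "s *\<^sub>R f \<in> ?N" using that by (simp add: convex_cone_hull_mul)
      then have "c + s *\<^sub>R f \<in> ?S" using hull_inc[OF \<open>c \<in> C\<close>, of convex] by blast
      from y[OF this] show ?thesis by (simp add: inner_add_right)
    qed
    obtain c0 where c0: "c0 \<in> C" using C by auto
    have "0 < y \<bullet> c" if "c \<in> C" for c
      using pos[OF that convex_cone_hull_contains_0, of 0] b by simp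
    moreover have "0 \<le> y \<bullet> f" if "f \<in> F" for f
    proof (rule ccontr)
      assume neg: "\<not> 0 \<le> y \<bullet> f"
      have "0 < y \<bullet> c0"
        using pos[OF c0 convex_cone_hull_contains_0, of 0] b by simp
      \<comment> \<open>This scale cancels \<open>y \<bullet> c0\<close>, so that \<open>pos\<close>
        would give \<open>b < 0\<close>.\<close>
      then have "0 \<le> (y \<bullet> c0) / - (y \<bullet> f)"
        using neg by (intro divide_nonneg_pos) auto
      from pos[OF c0 hull_inc[OF that] this] neg b show False
        by (simp add: field_simps)
    qed
    ultimately show ?thesis by blast
  next
    case True
    then obtain k v where k: "k \<in> convex hull C" and v: "v \<in> ?N" and kv: "k + v = 0"
      by auto
    have "convex hull C \<subseteq> {x. 0 \<le> e \<bullet> x}"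
      using eC by (intro hull_minimal) (auto simp: convex_halfspace_ge)
    moreover have "?N \<subseteq> {x. 0 \<le> e \<bullet> x}"
      using eF by (intro hull_minimal) (auto simp: convex_cone_halfspace_ge)
    moreover have "e \<bullet> k + e \<bullet> v = 0"
      using kv by (metis inner_add_right inner_zero_right)
    ultimately have ek: "e \<bullet> k = 0" using k v by (smt (verit) mem_Collect_eq subsetD)
    let ?H = "{x. e \<bullet> x = 0}"
    have "k \<in> convex hull (C \<inter> ?H)"
    proof -
      obtain S u where S: "finite S" "S \<subseteq> C" "\<forall>x\<in>S. 0 \<le> u x" "sum u S = 1" "(\<Sum>x\<in>S. u x *\<^sub>R x) = k"
        using k unfolding convex_hull_explicit by auto
      have "(\<Sum>x\<in>S. u x * (e \<bullet> x)) = 0"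
        using ek S(5) by (auto simp: inner_sum_right)
      then have z: "u x * (e \<bullet> x) = 0" if "x \<in> S" for x
        using that S eC by (subst (asm) sum_nonneg_eq_0_iff) auto
      let ?S = "{x\<in>S. u x \<noteq> 0}"
      have "sum u ?S = 1"
        using S by (simp add: sum.mono_neutral_left[of S ?S u])
      moreover have "(\<Sum>x\<in>?S. u x *\<^sub>R x) = k"
        unfolding S(5)[symmetric] using S(1) by (intro sum.mono_neutral_left) auto
      ultimately show ?thesis
        unfolding convex_hull_explicit using S z by (auto intro!: exI[of _ ?S] exI[of _ u])
    qed
    then obtain S u where S: "finite S" "S \<subseteq> C \<inter> ?H" "int (card S) \<le> aff_dim (C \<inter> ?H) + 1"
      "\<forall>x\<in>S. 0 \<le> u x" "sum u S = 1" "(\<Sum>x\<in>S. u x *\<^sub>R x) = k"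
      unfolding convex_hull_caratheodory_aff_dim by auto
    have "aff_dim (C \<inter> ?H) \<le> int DIM('a) - 1"
      using aff_dim_subset[of "C \<inter> ?H" ?H] \<open>e \<noteq> 0\<close> by simp
    then have cS: "card S \<le> DIM('a)" using S(3) by linarith
    \<comment> \<open>Zero weights are discarded because strictly positive ones are
      required.\<close>
    let ?S = "{x\<in>S. u x \<noteq> 0}"
    have "?comb"
    proof (intro exI conjI ballI)
      show "finite ?S" "?S \<subseteq> C" using S by auto
      show "card ?S \<le> DIM('a)"
        using cS card_mono[of S ?S] S(1) by auto
      show "0 < u d" if "d \<in> ?S" for d using that S(4) by force
      show "sum u ?S = 1"
        using S by (simp add: sum.mono_neutral_left[of S ?S u])
      have "(\<Sum>x\<in>?S. u x *\<^sub>R x) = k"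
        unfolding S(6)[symmetric] using S(1) by (intro sum.mono_neutral_left) auto
      then show "(\<Sum>d\<in>?S. u d *\<^sub>R d) + v = 0" using kv by simp
    qed (rule v)
    then show ?thesis ..
  qed
qed

section \<open>Supports and the sets \<open>Omega\<close>\<close>

lemma symmetric_form_commute:
  fixes M :: "real ^ 'n ^ 'n"
  assumes "transpose M = M"
  shows "u \<bullet> (M *v v) = v \<bullet> (M *v u)"
  by (metis assms dot_lmul_matrix inner_commute transpose_matrix_vector)

lemma symmetric_form_add:
  fixes M :: "real ^ 'n ^ 'n"
  assumes "transpose M = M"
  shows "(a *\<^sub>R s + b *\<^sub>R r) \<bullet> (M *v (a *\<^sub>R s + b *\<^sub>R r)) =
    a\<^sup>2 * (s \<bullet> (M *v s)) + 2 * a * b * (r \<bullet> (M *v s)) + b\<^sup>2 * (r \<bullet> (M *v r))"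
  using symmetric_form_commute[OF assms, of s r]
  by (simp add: matrix_vector_right_distrib matrix_vector_mult_scaleR inner_add_left inner_add_right
      power2_eq_square algebra_simps)

lemma simplex_nonneg: "t \<in> std_simplex \<Longrightarrow> 0 \<le> t $ k"
  by (auto simp: std_simplex_def nonneg_orthant_def)

lemma simplex_sum: "t \<in> std_simplex \<Longrightarrow> (\<Sum>k\<in>UNIV. t $ k) = 1"
  by (auto simp: std_simplex_def)

lemma Ppos_nonempty: "t \<in> std_simplex \<Longrightarrow> Ppos t \<noteq> {}"
proof
  assume t: "t \<in> std_simplex" "Ppos t = {}"
  then have "t $ k = 0" for k using simplex_nonneg[OF t(1), of k] by (auto simp: Ppos_def not_less intro: antisym)
  then show False using simplex_sum[OF t(1)] by simp
qed

lemma not_Ppos: "t \<in> std_simplex \<Longrightarrow> k \<notin> Ppos t \<Longrightarrow> t $ k = 0"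
  using simplex_nonneg[of t k] by (auto simp: Ppos_def)

lemma simplex_inner_nonneg:
  "t \<in> std_simplex \<Longrightarrow> (\<And>k. 0 \<le> w $ k) \<Longrightarrow> 0 \<le> t \<bullet> w"
  by (simp add: inner_vec_def sum_nonneg simplex_nonneg)

lemma compact_std_simplex: "compact (std_simplex :: (real^'p) set)"
proof -
  have "closed (std_simplex :: (real^'p) set)"
  proof -
    have *: "std_simplex = (\<Inter>k. {t :: real^'p. 0 \<le> t $ k}) \<inter> {t. (\<Sum>k\<in>UNIV. t $ k) = 1}"
      by (auto simp: std_simplex_def nonneg_orthant_def)
    show ?thesis
      unfolding *
      by (intro closed_Int closed_INT ballI closed_Collect_le closed_Collect_eq continuous_intros)
  qed
  moreover have "norm t \<le> 1" if "t \<in> std_simplex" for t :: "real^'p"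
    using norm_le_l1_cart[of t] simplex_nonneg[OF that] simplex_sum[OF that] by simp
  ultimately show ?thesis
    by (auto simp: compact_eq_bounded_closed bounded_iff)
qed

lemma axis_in_simplex: "axis k 1 \<in> (std_simplex :: (real^'p) set)"
  by (auto simp: std_simplex_def nonneg_orthant_def axis_def)

text \<open>The number \<open>\<theta>\<close> is the largest one with \<open>t - \<theta> s \<ge> 0\<close>.\<close>

lemma simplex_split:
  assumes s: "s \<in> std_simplex" and t: "t \<in> std_simplex" and sub: "Ppos s \<subseteq> Ppos t" and "t \<noteq> s"
  obtains \<theta> r where "0 < \<theta>" "\<theta> < 1" "r \<in> std_simplex" "Ppos r \<subset> Ppos t"
    "t = \<theta> *\<^sub>R s + (1 - \<theta>) *\<^sub>R r"
proof -
  define \<theta> where "\<theta> = Min ((\<lambda>k. t $ k / s $ k) ` Ppos s)"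
  have ne: "finite ((\<lambda>k. t $ k / s $ k) ` Ppos s)" "(\<lambda>k. t $ k / s $ k) ` Ppos s \<noteq> {}"
    using Ppos_nonempty[OF s] by auto
  \<comment> \<open>The minimum is attained at \<open>l\<close>; this coordinate will vanish in
    \<open>r\<close>, which makes the support strictly smaller.\<close>
  from Min_in[OF this] obtain l where l: "l \<in> Ppos s" "\<theta> = t $ l / s $ l"
    unfolding \<theta>_def by auto
  have le: "\<theta> * s $ k \<le> t $ k" for k
  proof (cases "k \<in> Ppos s")
    case True
    then have "\<theta> \<le> t $ k / s $ k" unfolding \<theta>_def by simp
    then show ?thesis using True by (simp add: Ppos_def field_simps)
  next
    case False
    then show ?thesis using not_Ppos[OF s] simplex_nonneg[OF t] by simp
  qed
  have pos: "0 < \<theta>" using l sub by (auto simp: Ppos_def)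
  have "(\<Sum>k\<in>UNIV. \<theta> * s $ k) = \<theta>"
    using simplex_sum[OF s] by (simp flip: sum_distrib_left)
  then have sum: "(\<Sum>k\<in>UNIV. t $ k - \<theta> * s $ k) = 1 - \<theta>"
    using simplex_sum[OF t] by (simp add: sum_subtractf)
  \<comment> \<open>Otherwise \<theta> = 1, and \<open>t - s\<close> has nonnegative entries with
    sum 0.\<close>
  have "\<theta> < 1"
  proof (rule ccontr)
    assume "\<not> \<theta> < 1"
    moreover have "0 \<le> 1 - \<theta>" unfolding sum[symmetric] by (rule sum_nonneg) (simp add: le)
    ultimately have "\<theta> = 1" by simp
    then have "t $ k - s $ k = 0" for k
      using sum le by (simp add: sum_nonneg_eq_0_iff)
    then have "t = s" by (simp add: vec_eq_iff)
    then show False using \<open>t \<noteq> s\<close> by simp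
  qed
  \<comment> \<open>The remainder has total mass \<open>1 - \<theta>\<close>; dividing by it returns
    to the simplex.\<close>
  define r where "r = (1 / (1 - \<theta>)) *\<^sub>R (t - \<theta> *\<^sub>R s)"
  have rk: "r $ k = (t $ k - \<theta> * s $ k) / (1 - \<theta>)" for k
    by (simp add: r_def)
  show thesis
  proof (rule that)
    show "0 < \<theta>" "\<theta> < 1" by fact+
    show "r \<in> std_simplex"
      using \<open>\<theta> < 1\<close> le sum
      by (simp add: std_simplex_def nonneg_orthant_def rk flip: sum_divide_distrib)
    have "r $ l = 0" "0 < s $ l" using l by (auto simp: rk Ppos_def)
    then have "l \<in> Ppos t - Ppos r" using l sub by (auto simp: Ppos_def)
    moreover have "Ppos r \<subseteq> Ppos t"
    proof
      fix k assume "k \<in> Ppos r"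
      then have "\<theta> * s $ k < t $ k" using \<open>\<theta> < 1\<close> by (simp add: Ppos_def rk zero_less_divide_iff)
      moreover have "0 \<le> \<theta> * s $ k" using pos simplex_nonneg[OF s] by simp
      ultimately show "k \<in> Ppos t" unfolding Ppos_def mem_Collect_eq by linarith
    qed
    ultimately show "Ppos r \<subset> Ppos t" by blast
    show "t = \<theta> *\<^sub>R s + (1 - \<theta>) *\<^sub>R r"
      using \<open>\<theta> < 1\<close> by (simp add: r_def)
  qed
qed

text \<open>A lower bound for an infimum is a lower bound for each member, so \<open>rho\<close> can
  be handled pointwise. The values are bounded below by 0.\<close>

lemma le_rho_iff:
  "B \<noteq> {} \<Longrightarrow> c \<le> rho l B \<longleftrightarrow> (\<forall>\<tau>\<in>B. c \<le> (\<Sum>k\<in>UNIV. \<bar>l $ k - \<tau> $ k\<bar>))"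
  unfolding rho_def by (subst le_cINF_iff) (auto intro!: bdd_belowI[where m = 0] sum_nonneg)

text \<open>Pointwise in the hull, the distance condition is a non-strict inequality between
  continuous functions of \<open>t\<close>.\<close>

lemma closed_Omega:
  assumes "V \<noteq> {}"
  shows "closed (Omega V)"
proof -
  have "Omega V = std_simplex \<inter>
      (\<Inter>\<tau>\<in>convex hull V. {t. sigma V \<le> (\<Sum>k\<in>UNIV. \<bar>t $ k - \<tau> $ k\<bar>)})"
    using assms by (auto simp: Omega_def le_rho_iff)
  then show ?thesis
    using compact_std_simplex
    by (auto intro!: closed_Int closed_INT closed_Collect_le continuous_intros dest: compact_imp_closed)
qed

lemma Omega_simplex: "t \<in> Omega V \<Longrightarrow> t \<in> std_simplex"
  by (simp add: Omega_def)

section \<open>Geometry of \<open>Omega V\<close> for finite \<open>V\<close>\<close>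

context
  fixes V :: "(real ^ 'p) set"
  assumes V: "finite V" "V \<noteq> {}" "V \<subseteq> std_simplex"
begin

text \<open>Shows that the minimum in \<open>sigma\<close> ranges over the image of a finite
  set.\<close>

lemma sigma_set: "{\<tau> $ k | \<tau> k. \<tau> \<in> V \<and> k \<in> Ppos \<tau>} = (\<lambda>(\<tau>, k). \<tau> $ k) ` Sigma V Ppos"
  by force

lemma sigma_le: "s \<in> V \<Longrightarrow> k \<in> Ppos s \<Longrightarrow> sigma V \<le> s $ k"
  unfolding sigma_def sigma_set using V(1) by (intro Min_le) force+

lemma sigma_pos: "0 < sigma V"
proof -
  have "Sigma V Ppos \<noteq> {}" using V Ppos_nonempty by blast
  then have "sigma V \<in> (\<lambda>(\<tau>, k). \<tau> $ k) ` Sigma V Ppos"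
    unfolding sigma_def sigma_set using V(1) by (intro Min_in) auto
  then show ?thesis by (auto simp: Ppos_def)
qed

text \<open>A point of \<open>V\<close> has distance 0 to the hull, whereas \<open>sigma V\<close>
  is positive.\<close>

lemma not_in_Omega: "s \<in> V \<Longrightarrow> s \<notin> Omega V"
  using sigma_pos V(2) hull_inc[of s V convex] by (force simp: Omega_def le_rho_iff)

text \<open>The weight that a point of \<open>convex hull V\<close> puts outside the support of \<open>t\<close> is a lower bound
  for its distance to \<open>t\<close>; if no \<open>\<tau> \<in> V\<close> has its support in that of \<open>t\<close>, it is at least \<open>sigma V\<close>.\<close>

lemma support_subset_outside_Omega:
  assumes t: "t \<in> std_simplex" "t \<notin> Omega V"
  shows "\<exists>s\<in>V. Ppos s \<subseteq> Ppos t"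
proof (rule ccontr)
  assume contra: "\<not> (\<exists>s\<in>V. Ppos s \<subseteq> Ppos t)"
  let ?Z = "- Ppos t"
  have "V \<subseteq> {v. sigma V \<le> (\<Sum>k\<in>?Z. v $ k)}"
  proof clarify
    fix s assume s: "s \<in> V"
    then obtain k where k: "k \<in> Ppos s" "k \<in> ?Z" using contra by blast
    have "s $ k \<le> (\<Sum>k\<in>?Z. s $ k)"
      using k s V(3) by (intro member_le_sum) (auto intro: simplex_nonneg)
    then show "sigma V \<le> (\<Sum>k\<in>?Z. s $ k)" using sigma_le[OF s k(1)] by simp
  qed
  moreover have "convex {v :: real^'p. sigma V \<le> (\<Sum>k\<in>?Z. v $ k)}"
  proof (rule convexI)
    fix x y :: "real^'p" and a b :: real
    assume *: "x \<in> {v. sigma V \<le> (\<Sum>k\<in>?Z. v $ k)}" "y \<in> {v. sigma V \<le> (\<Sum>k\<in>?Z. v $ k)}"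
      "0 \<le> a" "0 \<le> b" "a + b = 1"
    then have "a * sigma V + b * sigma V \<le> a * (\<Sum>k\<in>?Z. x $ k) + b * (\<Sum>k\<in>?Z. y $ k)"
      by (intro add_mono mult_left_mono) auto
    then show "a *\<^sub>R x + b *\<^sub>R y \<in> {v. sigma V \<le> (\<Sum>k\<in>?Z. v $ k)}"
      using \<open>a + b = 1\<close> by (simp add: sum.distrib sum_distrib_left flip: distrib_right)
  qed
  ultimately have hull: "convex hull V \<subseteq> {v. sigma V \<le> (\<Sum>k\<in>?Z. v $ k)}"
    by (rule hull_minimal)
  have "sigma V \<le> (\<Sum>k\<in>UNIV. \<bar>t $ k - v $ k\<bar>)" if "v \<in> convex hull V" for v
  proof -
    have "sigma V \<le> (\<Sum>k\<in>?Z. v $ k)" using hull that by auto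
    also have "\<dots> \<le> (\<Sum>k\<in>?Z. \<bar>t $ k - v $ k\<bar>)"
      using not_Ppos[OF t(1)] by (intro sum_mono) auto
    also have "\<dots> \<le> (\<Sum>k\<in>UNIV. \<bar>t $ k - v $ k\<bar>)" by (intro sum_mono2) auto
    finally show ?thesis .
  qed
  then show False using t V(2) by (auto simp: Omega_def le_rho_iff)
qed

text \<open>Mix a hull point \<open>v\<close> with \<open>s\<close> in the same proportion as
  \<open>r\<close>: the result stays in the hull, and the difference of the two mixtures is
  \<open>(1 - \<theta>)\<close> times \<open>r - v\<close>. Hence \<open>r\<close> is at least as
  far from \<open>v\<close> as the mixture is from the hull.\<close>

lemma Omega_extrapolate:
  assumes t: "\<theta> *\<^sub>R s + (1 - \<theta>) *\<^sub>R r \<in> Omega V" and "s \<in> V" "r \<in> std_simplex" and \<theta>: "0 < \<theta>" "\<theta> < 1"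
  shows "r \<in> Omega V"
proof -
  have "sigma V \<le> (\<Sum>k\<in>UNIV. \<bar>r $ k - v $ k\<bar>)" if v: "v \<in> convex hull V" for v
  proof -
    let ?t = "\<theta> *\<^sub>R s + (1 - \<theta>) *\<^sub>R r" and ?v = "\<theta> *\<^sub>R s + (1 - \<theta>) *\<^sub>R v"
    have "?v \<in> convex hull V"
      using convexD[OF convex_convex_hull hull_inc[OF \<open>s \<in> V\<close>] v, of \<theta> "1 - \<theta>"] \<theta> by simp
    then have "sigma V \<le> (\<Sum>k\<in>UNIV. \<bar>?t $ k - ?v $ k\<bar>)"
      using t V(2) by (auto simp: Omega_def le_rho_iff)
    also have "\<dots> = (\<Sum>k\<in>UNIV. (1 - \<theta>) * \<bar>r $ k - v $ k\<bar>)"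
    proof (rule sum.cong)
      fix k
      have "?t $ k - ?v $ k = (1 - \<theta>) * (r $ k - v $ k)" by (simp add: algebra_simps)
      then show "\<bar>?t $ k - ?v $ k\<bar> = (1 - \<theta>) * \<bar>r $ k - v $ k\<bar>" using \<theta> by (simp add: abs_mult)
    qed simp
    also have "\<dots> \<le> (\<Sum>k\<in>UNIV. \<bar>r $ k - v $ k\<bar>)"
      using \<theta> by (intro sum_mono mult_left_le_one_le) auto
    finally show ?thesis .
  qed
  then show ?thesis using V(2) \<open>r \<in> std_simplex\<close> by (auto simp: Omega_def le_rho_iff)
qed

section \<open>Quadratic forms that have a nonnegative gradient on \<open>V\<close>\<close>

context
  fixes M :: "real ^ 'p ^ 'p"
  assumes sym: "transpose M = M" and MV: "\<And>s k. s \<in> V \<Longrightarrow> 0 \<le> (M *v s) $ k"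
begin

text \<open>In the expanded square, the \<open>s\<close>-term and the mixed term are nonnegative
  because \<open>M *v s\<close> is; only the \<open>r\<close>-term is kept.\<close>

lemma form_split_ge:
  assumes "s \<in> V" "r \<in> std_simplex" "0 < \<theta>" "\<theta> < 1"
  shows "(1 - \<theta>)\<^sup>2 * (r \<bullet> (M *v r)) \<le>
    (\<theta> *\<^sub>R s + (1 - \<theta>) *\<^sub>R r) \<bullet> (M *v (\<theta> *\<^sub>R s + (1 - \<theta>) *\<^sub>R r))"
proof -
  have "0 \<le> s \<bullet> (M *v s)" "0 \<le> r \<bullet> (M *v s)"
    using assms V(3) MV by (auto intro!: simplex_inner_nonneg)
  then show ?thesis
    unfolding symmetric_form_add[OF sym] using assms by simp
qed

text \<open>Reduces positivity on \<open>Omega V\<close> to the points that satisfy the support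
  condition imposed on new points in \<open>iteration_data\<close>. Splitting off \<open>s\<close>
  stays inside \<open>Omega V\<close> while the support shrinks.\<close>

lemma form_pos_on_Omega:
  assumes red: "\<And>t. t \<in> Omega V \<Longrightarrow> (\<And>s. s \<in> V \<Longrightarrow> \<not> Ppos s \<subseteq> Ppos t) \<Longrightarrow> 0 < t \<bullet> (M *v t)"
  shows "t \<in> Omega V \<Longrightarrow> 0 < t \<bullet> (M *v t)"
proof (induction "card (Ppos t)" arbitrary: t rule: less_induct)
  case less
  show ?case
  proof (cases "\<exists>s\<in>V. Ppos s \<subseteq> Ppos t")
    case False
    then show ?thesis using red less.prems by blast
  next
    case True
    then obtain s where s: "s \<in> V" "Ppos s \<subseteq> Ppos t" by blast
    have "t \<noteq> s" using not_in_Omega s less.prems by blast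
    then obtain \<theta> r where r: "0 < \<theta>" "\<theta> < 1" "r \<in> std_simplex" "Ppos r \<subset> Ppos t"
      and t: "t = \<theta> *\<^sub>R s + (1 - \<theta>) *\<^sub>R r"
      using simplex_split[of s t] s V(3) Omega_simplex[OF less.prems] by blast
    have "0 < r \<bullet> (M *v r)"
      using Omega_extrapolate less r s t by (metis finite psubset_card_mono)
    then have "0 < (1 - \<theta>)\<^sup>2 * (r \<bullet> (M *v r))" using r by simp
    also have "\<dots> \<le> t \<bullet> (M *v t)" unfolding t using form_split_ge s r by blast
    finally show ?thesis .
  qed
qed

text \<open>This is how the regularized constraints imply copositivity. The point \<open>r\<close>
  may fall inside or outside \<open>Omega V\<close>, so the induction runs over the whole
  simplex.\<close>

lemma form_nonneg_on_simplex:
  assumes Om: "\<And>t. t \<in> Omega V \<Longrightarrow> 0 \<le> t \<bullet> (M *v t)"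
  shows "t \<in> std_simplex \<Longrightarrow> 0 \<le> t \<bullet> (M *v t)"
proof (induction "card (Ppos t)" arbitrary: t rule: less_induct)
  case less
  consider "t \<in> Omega V" | "t \<in> V" | "t \<notin> Omega V" "t \<notin> V" by blast
  then show ?case
  proof cases
    case 2
    then show ?thesis using less.prems MV by (simp add: simplex_inner_nonneg)
  next
    case 3
    then obtain s where s: "s \<in> V" "Ppos s \<subseteq> Ppos t"
      using support_subset_outside_Omega less.prems by blast
    then have "t \<noteq> s" using 3 by blast
    then obtain \<theta> r where r: "0 < \<theta>" "\<theta> < 1" "r \<in> std_simplex" "Ppos r \<subset> Ppos t"
      and t: "t = \<theta> *\<^sub>R s + (1 - \<theta>) *\<^sub>R r"
      using simplex_split[of s t] s V(3) less.prems by blast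
    have "0 \<le> r \<bullet> (M *v r)"
      using less.hyps r by (metis finite psubset_card_mono)
    then have "0 \<le> (1 - \<theta>)\<^sup>2 * (r \<bullet> (M *v r))" by simp
    also have "\<dots> \<le> t \<bullet> (M *v t)" unfolding t using form_split_ge s r by blast
    finally show ?thesis .
  qed (rule Om)
qed

end
end

section \<open>The data equations as a vector equation in \<open>\<real>\<^sup>n\<^sup>+\<^sup>1\<close>\<close>

text \<open>The homogenised pencil: the coefficient of \<open>A0\<close> becomes a free
  variable.\<close>

definition comb :: "real ^ 'p ^ 'p \<Rightarrow> ('n::finite \<Rightarrow> real ^ 'p ^ 'p) \<Rightarrow> real \<times> (real ^ 'n) \<Rightarrow> real ^ 'p ^ 'p" where
  "comb A0 A y = fst y *\<^sub>R A0 + (\<Sum>i\<in>UNIV. snd y $ i *\<^sub>R A i)"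

text \<open>Two separate arguments let one map serve both data sums: \<open>u = v\<close> for the
  weighted points, and \<open>u\<close> a multiplier vector for the old points.\<close>

definition coef :: "real ^ 'p ^ 'p \<Rightarrow> ('n::finite \<Rightarrow> real ^ 'p ^ 'p) \<Rightarrow> real ^ 'p \<Rightarrow> real ^ 'p \<Rightarrow> real \<times> (real ^ 'n)" where
  "coef A0 A u v = (u \<bullet> (A0 *v v), \<chi> i. u \<bullet> (A i *v v))"

lemma inner_sum_matrix_vector:
  fixes u v :: "real ^ 'p" and B :: "'n \<Rightarrow> real ^ 'p ^ 'p"
  shows "finite I \<Longrightarrow> u \<bullet> ((\<Sum>i\<in>I. B i) *v v) = (\<Sum>i\<in>I. u \<bullet> (B i *v v))"
  by (induction I rule: finite_induct) (auto simp: matrix_vector_mult_add_rdistrib inner_add_right)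

text \<open>Duality between the two maps: a separating vector \<open>y\<close> in the coefficient
  space is read as a matrix.\<close>

lemma inner_coef: "y \<bullet> coef A0 A u v = u \<bullet> (comb A0 A y *v v)"
  by (simp add: coef_def comb_def inner_prod_def inner_vec_def[of "snd y"] inner_sum_matrix_vector
      matrix_vector_mult_add_rdistrib inner_add_right flip: scaleR_matrix_vector_assoc)

lemma comb_pencil: "comb A0 A (1, x) = pencil A0 A x"
  by (simp add: comb_def pencil_def)

lemma inner_coef_pencil: "(1, x) \<bullet> coef A0 A u v = u \<bullet> (pencil A0 A x *v v)"
  by (simp add: inner_coef comb_pencil)

lemma comb_add_scaleR: "comb A0 A (y + s *\<^sub>R z) = comb A0 A y + s *\<^sub>R comb A0 A z"
  by (simp add: comb_def algebra_simps scaleR_sum_right sum.distrib)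

lemma coef_add_left: "coef A0 A (u + w) v = coef A0 A u v + coef A0 A w v"
  by (auto simp: coef_def inner_add_left vec_eq_iff)

lemma coef_scaleR_left: "coef A0 A (c *\<^sub>R u) v = c *\<^sub>R coef A0 A u v"
  by (auto simp: coef_def vec_eq_iff)

lemma coef_zero_left: "coef A0 A 0 v = 0"
  by (auto simp: coef_def vec_eq_iff zero_prod_def)

lemma transpose_comb:
  assumes "transpose A0 = A0" "\<And>i. transpose (A i) = A i"
  shows "transpose (comb A0 A y) = comb A0 A y"
proof -
  have "A0 $ i $ j = A0 $ j $ i" "A k $ i $ j = A k $ j $ i" for i j k
    using assms by (auto simp: transpose_def vec_eq_iff)
  then show ?thesis
    by (simp add: comb_def transpose_def vec_eq_iff)
qed

lemma transpose_pencil: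
  assumes "transpose A0 = A0" "\<And>i. transpose (A i) = A i"
  shows "transpose (pencil A0 A x) = pencil A0 A x"
  using transpose_comb[OF assms, where y = "(1, x)"] by (simp add: comb_pencil)

text \<open>A separating \<open>y\<close> may have any first component. Adding
  \<open>1 + \<bar>fst y\<bar>\<close> times \<open>(1, xbar)\<close> makes it positive, and
  dividing by it leaves a vector \<open>(1, x)\<close>. All \<open>u\<close>, \<open>v\<close> are
  allowed so that the identity covers both the quadratic and the linear constraints.\<close>

lemma normalise_direction:
  "\<exists>x r s. 0 < r \<and> 0 \<le> s \<and> (\<forall>u v. r * (u \<bullet> (pencil A0 A x *v v)) =
    u \<bullet> (comb A0 A y *v v) + s * (u \<bullet> (pencil A0 A xbar *v v)))"
proof (intro exI conjI allI)
  define s where "s = 1 + \<bar>fst y\<bar>"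
  define z where "z = y + s *\<^sub>R (1, xbar)"
  show pos: "0 < fst z" by (simp add: z_def s_def)
  show "0 \<le> s" by (simp add: s_def)
  have "z = fst z *\<^sub>R (1, (1 / fst z) *\<^sub>R snd z)" using pos by (simp add: prod_eq_iff)
  then have "fst z * (u \<bullet> (pencil A0 A ((1 / fst z) *\<^sub>R snd z) *v v)) = z \<bullet> coef A0 A u v" for u v
    by (metis inner_coef_pencil inner_scaleR_left)
  then show "fst z * (u \<bullet> (pencil A0 A ((1 / fst z) *\<^sub>R snd z) *v v)) =
    u \<bullet> (comb A0 A y *v v) + s * (u \<bullet> (pencil A0 A xbar *v v))" for u v
    by (simp add: z_def inner_coef comb_add_scaleR comb_pencil matrix_vector_mult_add_rdistrib
        inner_add_right del: scaleR_Pair flip: scaleR_matrix_vector_assoc)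
qed

lemma data_equation_iff:
  "(\<forall>M\<in>insert A0 (range A). (\<Sum>i\<in>I. \<gamma> i * (\<tau> i \<bullet> (M *v \<tau> i))) +
      2 * (\<Sum>i\<in>J. \<Lambda> i \<bullet> (M *v \<rho> i)) = 0) \<longleftrightarrow>
   (\<Sum>i\<in>I. \<gamma> i *\<^sub>R coef A0 A (\<tau> i) (\<tau> i)) + 2 *\<^sub>R (\<Sum>i\<in>J. coef A0 A (\<Lambda> i) (\<rho> i)) = 0"
  by (auto simp: coef_def prod_eq_iff vec_eq_iff fst_sum snd_sum)

lemma initial_equation_iff:
  "(\<forall>M\<in>insert A0 (range A). (\<Sum>i\<in>I. \<gamma> i * (\<tau> i \<bullet> (M *v \<tau> i))) = 0) \<longleftrightarrow>
   (\<Sum>i\<in>I. \<gamma> i *\<^sub>R coef A0 A (\<tau> i) (\<tau> i)) = 0"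
  using data_equation_iff[where J = "{}"] by simp

lemma axis_inner: "axis k 1 \<bullet> w = (w :: real^'p) $ k"
  by (simp add: inner_axis')

lemma continuous_on_coef: "continuous_on S (\<lambda>t. coef A0 A t t)"
  unfolding coef_def
  by (intro continuous_intros matrix_vector_mult_linear_continuous_on)

lemma continuous_on_form: "continuous_on S (\<lambda>t :: real^'p. t \<bullet> (M *v t))"
  by (intro continuous_intros matrix_vector_mult_linear_continuous_on)

text \<open>Supplies \<open>\<mu> = - \<delta>\<close> for the stopping tests. The empty set is
  treated too, since \<open>Omega V\<close> is not known to be nonempty.\<close>

lemma positive_margin:
  assumes "compact K" "continuous_on K f" "\<forall>t\<in>K. (0::real) < f t"
  shows "\<exists>\<delta>>0. \<forall>t\<in>K. \<delta> \<le> f t"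
proof (cases "K = {}")
  case True
  then show ?thesis using zero_less_one by blast
next
  case False
  then obtain a where "a \<in> K" "\<forall>t\<in>K. f a \<le> f t"
    using continuous_attains_inf assms by blast
  then show ?thesis using assms(3) by blast
qed

text \<open>The conic alternative yields a set of coefficient vectors, but the algorithm wants
  labelled points: each vector gets a label outside \<open>B\<close> and one preimage, and the
  bijection reindexes the sums.\<close>

lemma label_points:
  assumes D: "finite D" "D \<subseteq> f ` S" and "finite (B :: nat set)"
  shows "\<exists>I g. finite I \<and> I \<inter> B = {} \<and> card I = card D \<and> (\<forall>i\<in>I. g i \<in> S) \<and>
    bij_betw (\<lambda>i. f (g i)) I D"
proof -
  have "infinite (- B)" using \<open>finite B\<close> by simp
  then obtain I where I: "finite I" "card I = card D" "I \<subseteq> - B"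
    using infinite_arbitrarily_large by blast
  then obtain h where h: "bij_betw h I D" using D finite_same_card_bij by blast
  have "\<exists>s. s \<in> S \<and> f s = h i" if "i \<in> I" for i
    using that h D by (force simp: bij_betw_def)
  then obtain g where g: "\<And>i. i \<in> I \<Longrightarrow> g i \<in> S \<and> f (g i) = h i" by metis
  have "bij_betw (\<lambda>i. f (g i)) I D" using h g by (simp cong: bij_betw_cong)
  with I g show ?thesis by blast
qed

section \<open>Correctness and termination of the algorithm\<close>

text \<open>The loop invariant: the claim of the theorem about the current data, together with
  finiteness and nonemptiness of the label set.\<close>

definition valid_state :: "real ^ 'p ^ 'p \<Rightarrow> ('n::finite \<Rightarrow> real ^ 'p ^ 'p) \<Rightarrow> ('p::finite) alg_state \<Rightarrow> bool" where
  "valid_state A0 A st \<longleftrightarrow> finite (idx st) \<and> idx st \<noteq> {} \<and>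
     (\<forall>i\<in>idx st. tau st i \<in> immobile A0 A \<and> Ppos (tau st i) \<subseteq> Lset st i \<and>
        (\<forall>k\<in>Lset st i. \<forall>x\<in>feasX A0 A. (pencil A0 A x *v tau st i) $ k = 0))"

lemma valid_Wset:
  assumes "valid_state A0 A st"
  shows "finite (Wset st)" "Wset st \<noteq> {}" "Wset st \<subseteq> std_simplex"
  using assms by (auto simp: valid_state_def Wset_def immobile_def)

section \<open>First-order conditions at immobile indices\<close>

lemma feasX_nonneg: "x \<in> feasX A0 A \<Longrightarrow> t \<in> std_simplex \<Longrightarrow> 0 \<le> t \<bullet> (pencil A0 A x *v t)"
  by (simp add: feasX_def COP_def std_simplex_def)

text \<open>An immobile \<open>t\<close> minimises the form over the orthant. If the
  \<open>k\<close>-th entry were negative, a short step from \<open>t\<close> along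
  \<open>axis k 1\<close> would make the form negative.\<close>

lemma immobile_gradient_nonneg:
  assumes x: "x \<in> feasX A0 A" and t: "t \<in> immobile A0 A"
  shows "0 \<le> (pencil A0 A x *v t) $ k"
proof (rule ccontr)
  let ?M = "pencil A0 A x"
  define d where "d = - (?M *v t) $ k"
  define m where "m = axis k 1 \<bullet> (?M *v axis k 1)"
  \<comment> \<open>Short enough that \<open>s * m \<le> d\<close>, so the second-order term cannot
    outweigh \<open>- 2 * d\<close>.\<close>
  define s where "s = d / (\<bar>m\<bar> + 1)"
  assume "\<not> 0 \<le> (?M *v t) $ k"
  then have d: "0 < d" by (simp add: d_def)
  then have s: "0 < s" by (simp add: s_def)
  have sym: "transpose ?M = ?M" using x by (simp add: feasX_def COP_def)
  have "t \<bullet> (?M *v t) = 0" using x t by (simp add: immobile_def)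
  then have "(1 *\<^sub>R t + s *\<^sub>R axis k 1) \<bullet> (?M *v (1 *\<^sub>R t + s *\<^sub>R axis k 1)) = s * (s * m - 2 * d)"
    unfolding symmetric_form_add[OF sym]
    by (simp add: axis_inner d_def m_def power2_eq_square algebra_simps)
  moreover have "1 *\<^sub>R t + s *\<^sub>R axis k 1 \<in> nonneg_orthant"
    using t s by (auto simp: immobile_def std_simplex_def nonneg_orthant_def axis_def)
  ultimately have "0 \<le> s * (s * m - 2 * d)"
    using x by (metis (mono_tags, lifting) COP_def feasX_def mem_Collect_eq)
  then have "2 * d \<le> s * m" using s by (simp add: zero_le_mult_iff)
  also have "s * m \<le> s * (\<bar>m\<bar> + 1)" using s by (intro mult_left_mono) auto
  also have "\<dots> = d" by (simp add: s_def)
  finally show False using d by simp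
qed

text \<open>Complementarity: the vanishing form is a sum of nonnegative products
  \<open>t $ k * ?w $ k\<close>.\<close>

lemma immobile_gradient_zero:
  assumes x: "x \<in> feasX A0 A" and t: "t \<in> immobile A0 A" and k: "k \<in> Ppos t"
  shows "(pencil A0 A x *v t) $ k = 0"
proof -
  let ?w = "pencil A0 A x *v t"
  have "(\<Sum>k\<in>UNIV. t $ k * ?w $ k) = 0"
    using x t by (simp add: immobile_def inner_vec_def)
  moreover have "0 \<le> t $ k * ?w $ k" for k
    using immobile_gradient_nonneg[OF x t] t by (simp add: immobile_def simplex_nonneg)
  ultimately have "t $ k * ?w $ k = 0" by (simp add: sum_nonneg_eq_0_iff)
  then show ?thesis using k by (simp add: Ppos_def)
qed

lemma valid_linear_constraints:
  assumes "valid_state A0 A st" "x \<in> feasX A0 A"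
  shows "linear_constraints A0 A st x"
  using assms immobile_gradient_nonneg[OF assms(2)]
  by (auto simp: linear_constraints_def valid_state_def axis_inner)

lemma linear_constraints_nonneg:
  assumes "linear_constraints A0 A st x" "s \<in> Wset st"
  shows "0 \<le> (pencil A0 A x *v s) $ k"
proof -
  obtain i where "i \<in> idx st" "s = tau st i" using assms by (auto simp: Wset_def)
  then show ?thesis
    using assms by (cases "k \<in> Lset st i") (auto simp: linear_constraints_def axis_inner)
qed

section \<open>Preservation of the invariant\<close>

text \<open>Pairing the data equation with \<open>(1, x)\<close> for feasible \<open>x\<close> gives
  a vanishing sum of nonnegative terms, so each term is 0.\<close>

lemma valid_initial_state:
  assumes "initial_data A0 A I \<tau> \<gamma>"
  shows "valid_state A0 A (initial_state I \<tau>)"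
proof -
  have im: "\<tau> i \<in> immobile A0 A" if i: "i \<in> I" for i
  proof -
    have "\<tau> i \<bullet> (pencil A0 A x *v \<tau> i) = 0" if x: "x \<in> feasX A0 A" for x
    proof -
      have "(\<Sum>i\<in>I. \<gamma> i *\<^sub>R coef A0 A (\<tau> i) (\<tau> i)) = 0"
        using assms unfolding initial_data_def initial_equation_iff by blast
      from arg_cong[OF this, of "(\<bullet>) (1, x)"]
      have "(\<Sum>i\<in>I. \<gamma> i * (\<tau> i \<bullet> (pencil A0 A x *v \<tau> i))) = 0"
        by (simp add: inner_sum_right inner_coef_pencil)
      moreover have "0 \<le> \<gamma> i * (\<tau> i \<bullet> (pencil A0 A x *v \<tau> i))" if "i \<in> I" for i
        using assms that feasX_nonneg[OF x]
        by (intro mult_nonneg_nonneg) (auto simp: initial_data_def intro: less_imp_le)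
      ultimately have "\<gamma> i * (\<tau> i \<bullet> (pencil A0 A x *v \<tau> i)) = 0"
        using i assms by (simp add: sum_nonneg_eq_0_iff initial_data_def)
      then show ?thesis using i assms by (auto simp: initial_data_def)
    qed
    then show ?thesis using i assms by (simp add: immobile_def initial_data_def)
  qed
  moreover have "\<forall>i\<in>I. \<forall>k\<in>Ppos (\<tau> i). \<forall>x\<in>feasX A0 A. (pencil A0 A x *v \<tau> i) $ k = 0"
    using im immobile_gradient_zero by blast
  ultimately show ?thesis
    using assms
    by (auto simp: valid_state_def initial_state_def initial_data_def)
qed

text \<open>Paired with \<open>(1, x)\<close>, the data equation again is a vanishing sum of
  nonnegative terms. The new points are therefore immobile, and a positive multiplier entry forces
  the corresponding gradient entry to vanish, which justifies enlarging \<open>Lset\<close>.\<close>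

lemma valid_next_state:
  assumes st: "valid_state A0 A st" and data: "iteration_data A0 A st J \<tau> \<gamma> \<Lambda>"
  shows "valid_state A0 A (next_state st J \<tau> \<Lambda>)"
proof -
  let ?I = "idx st"
  have J: "finite J" "finite ?I" "J \<inter> ?I = {}" and \<gamma>: "\<And>i. i \<in> J \<Longrightarrow> 0 < \<gamma> i"
    and \<tau>: "\<And>i. i \<in> J \<Longrightarrow> \<tau> i \<in> std_simplex"
    and \<Lambda>: "\<And>i k. i \<in> ?I \<Longrightarrow> k \<notin> Lset st i \<Longrightarrow> 0 \<le> \<Lambda> i $ k"
    using data st by (auto simp: iteration_data_def valid_state_def Omega_simplex)
  have tau_im: "\<And>i. i \<in> ?I \<Longrightarrow> tau st i \<in> immobile A0 A" using st by (simp add: valid_state_def)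
  have key: "(\<forall>i\<in>J. \<tau> i \<bullet> (pencil A0 A x *v \<tau> i) = 0) \<and>
      (\<forall>i\<in>?I. \<forall>k. \<Lambda> i $ k * (pencil A0 A x *v tau st i) $ k = 0)"
    if x: "x \<in> feasX A0 A" for x
  proof -
    let ?a = "\<lambda>i. \<gamma> i * (\<tau> i \<bullet> (pencil A0 A x *v \<tau> i))"
    let ?b = "\<lambda>i k. \<Lambda> i $ k * (pencil A0 A x *v tau st i) $ k"
    have "(\<Sum>i\<in>J. \<gamma> i *\<^sub>R coef A0 A (\<tau> i) (\<tau> i)) + 2 *\<^sub>R (\<Sum>i\<in>?I. coef A0 A (\<Lambda> i) (tau st i)) = 0"
      using data data_equation_iff unfolding iteration_data_def by blast
    from arg_cong[OF this, of "(\<bullet>) (1, x)"]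
    have eq: "(\<Sum>i\<in>J. ?a i) + 2 * (\<Sum>i\<in>?I. \<Sum>k\<in>UNIV. ?b i k) = 0"
      by (simp add: inner_sum_right inner_coef_pencil inner_add_right inner_vec_def[of "\<Lambda> _"])
    have a: "0 \<le> ?a i" if "i \<in> J" for i
      using that \<gamma>[OF that] \<tau>[OF that] feasX_nonneg[OF x] by simp
    \<comment> \<open>On \<open>Lset st i\<close> the multiplier may have any sign, but the gradient
      entry is 0 there.\<close>
    have b: "0 \<le> ?b i k" if "i \<in> ?I" for i k
    proof (cases "k \<in> Lset st i")
      case True
      then show ?thesis using st x that by (simp add: valid_state_def)
    next
      case False
      then show ?thesis using \<Lambda> that immobile_gradient_nonneg[OF x] tau_im by simp
    qed
    have "0 \<le> (\<Sum>i\<in>J. ?a i)" "0 \<le> (\<Sum>i\<in>?I. \<Sum>k\<in>UNIV. ?b i k)"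
      using a b by (auto intro!: sum_nonneg)
    with eq have "(\<Sum>i\<in>J. ?a i) = 0" "(\<Sum>i\<in>?I. \<Sum>k\<in>UNIV. ?b i k) = 0" by linarith+
    then have "\<forall>i\<in>J. ?a i = 0" "\<forall>i\<in>?I. \<forall>k. ?b i k = 0"
      using a b J by (simp_all add: sum_nonneg_eq_0_iff sum_nonneg)
    then show ?thesis using \<gamma> by force
  qed
  have im: "\<tau> i \<in> immobile A0 A" if "i \<in> J" for i
    using key that \<tau> by (simp add: immobile_def)
  then have "\<forall>i\<in>J. \<forall>k\<in>Ppos (\<tau> i). \<forall>x\<in>feasX A0 A. (pencil A0 A x *v \<tau> i) $ k = 0"
    using immobile_gradient_zero by blast
  moreover have "\<forall>i\<in>?I. \<forall>k. 0 < \<Lambda> i $ k \<longrightarrow> (\<forall>x\<in>feasX A0 A. (pencil A0 A x *v tau st i) $ k = 0)"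
    using key by (metis less_irrefl mult_eq_0_iff)
  ultimately show ?thesis
    using st J im by (auto simp: valid_state_def next_state_def)
qed

lemma valid_reached:
  assumes "reached A0 A S m" "0 < m"
  shows "valid_state A0 A (S m)"
  using assms
proof (induction m)
  case (Suc m)
  then show ?case
    using valid_initial_state valid_next_state
    by (cases "m = 0") (auto simp: iteration_result_def)
qed simp

section \<open>Existence of the data when a stopping test fails\<close>

text \<open>The conic alternative is applied without cone generators and with
  \<open>e = (1, xbar)\<close>. A separating \<open>y\<close> would normalise to a point passing the
  stopping test, so the convex combination remains.\<close>

lemma initial_data_exists:
  fixes A0 :: "real ^ 'p ^ 'p" and A :: "'n::finite \<Rightarrow> real ^ 'p ^ 'p"
  assumes xbar: "xbar \<in> feasX A0 A" and "\<not> stop_initial A0 A"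
  shows "\<exists>I \<tau> \<gamma>. initial_data A0 A I \<tau> \<gamma>"
proof -
  let ?f = "\<lambda>t. coef A0 A t t"
  have C: "compact (?f ` std_simplex)" "?f ` std_simplex \<noteq> {}"
    using compact_continuous_image[OF continuous_on_coef compact_std_simplex] axis_in_simplex by auto
  have eC: "\<forall>c\<in>?f ` std_simplex. 0 \<le> (1, xbar) \<bullet> c"
    using feasX_nonneg[OF xbar] by (auto simp: inner_coef_pencil)
  have eF: "\<forall>f\<in>{}. 0 \<le> (1, xbar) \<bullet> f" by simp
  have ne: "(1::real, xbar) \<noteq> 0" by (simp add: zero_prod_def)
  show ?thesis
    using conic_alternative[OF C finite.emptyI ne eC eF]
  proof (elim disjE exE conjE)
    fix y assume y: "\<forall>c\<in>?f ` std_simplex. 0 < y \<bullet> c"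
    obtain x r s where r: "0 < r" "0 \<le> s" "\<And>u v. r * (u \<bullet> (pencil A0 A x *v v)) =
        u \<bullet> (comb A0 A y *v v) + s * (u \<bullet> (pencil A0 A xbar *v v))"
      using normalise_direction[of A0 A y xbar] by blast
    have "0 < t \<bullet> (pencil A0 A x *v t)" if "t \<in> std_simplex" for t
    proof -
      have "0 < t \<bullet> (comb A0 A y *v t)" using y that by (auto simp: inner_coef)
      then have "0 < r * (t \<bullet> (pencil A0 A x *v t))"
        using r feasX_nonneg[OF xbar that] by (simp add: add_pos_nonneg)
      then show ?thesis using r(1) by (simp add: zero_less_mult_iff)
    qed
    then obtain \<delta> where "0 < \<delta>" "\<forall>t\<in>std_simplex. \<delta> \<le> t \<bullet> (pencil A0 A x *v t)"
      using positive_margin[OF compact_std_simplex continuous_on_form, of "pencil A0 A x"] by blast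
    then have "(x, - \<delta>) \<in> sip0_feasible A0 A" by (simp add: sip0_feasible_def)
    then have "stop_initial A0 A" using \<open>0 < \<delta>\<close> by (force simp: stop_initial_def)
    then show ?thesis using assms by simp
  next
    fix D u and v :: "real \<times> (real ^ 'n)"
    assume D: "finite D" "D \<subseteq> ?f ` std_simplex" "card D \<le> DIM(real \<times> (real ^ 'n))"
      "\<forall>d\<in>D. 0 < u d" "sum u D = 1" "v \<in> convex_cone hull {}" "(\<Sum>d\<in>D. u d *\<^sub>R d) + v = 0"
    obtain I :: "nat set" and \<tau> where I: "finite I" "card I = card D" "\<forall>i\<in>I. \<tau> i \<in> std_simplex"
      and bij: "bij_betw (\<lambda>i. ?f (\<tau> i)) I D"
      using label_points[OF D(1,2) finite.emptyI] by blast
    \<comment> \<open>The cone generated by the empty set is trivial, so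
      \<open>v = 0\<close>.\<close>
    have "(\<Sum>i\<in>I. u (?f (\<tau> i)) *\<^sub>R ?f (\<tau> i)) = 0"
      using sum.reindex_bij_betw[OF bij, of "\<lambda>d. u d *\<^sub>R d"] D by simp
    then have "\<forall>M\<in>insert A0 (range A). (\<Sum>i\<in>I. u (?f (\<tau> i)) * (\<tau> i \<bullet> (M *v \<tau> i))) = 0"
      unfolding initial_equation_iff .
    moreover have sum: "(\<Sum>i\<in>I. u (?f (\<tau> i))) = 1"
      using sum.reindex_bij_betw[OF bij, of u] D by simp
    moreover have "I \<noteq> {}" using sum by auto
    moreover have "0 < u (?f (\<tau> i))" if "i \<in> I" for i
      using bij_betwE[OF bij] that D by blast
    ultimately have "initial_data A0 A I \<tau> (\<lambda>i. u (?f (\<tau> i)))"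
      using I D by (auto simp: initial_data_def)
    then show ?thesis by blast
  qed
qed

text \<open>The compact set is built from \<open>R\<close>, not from all of \<open>Omega ?W\<close>,
  so that the points obtained satisfy the support condition; \<open>red\<close> recovers positivity
  on \<open>Omega ?W\<close>.\<close>

lemma iteration_data_exists:
  fixes A0 :: "real ^ 'p ^ 'p" and A :: "'n::finite \<Rightarrow> real ^ 'p ^ 'p"
  assumes sym: "transpose A0 = A0" "\<And>i. transpose (A i) = A i"
    and xbar: "xbar \<in> feasX A0 A" and st: "valid_state A0 A st" and "\<not> stop_at A0 A st"
  shows "\<exists>J \<tau> \<gamma> \<Lambda>. iteration_data A0 A st J \<tau> \<gamma> \<Lambda>"
proof -
  let ?I = "idx st" and ?W = "Wset st" and ?f = "\<lambda>t. coef A0 A t t"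
  define R where "R = {t \<in> Omega ?W. \<forall>s\<in>?W. \<not> Ppos s \<subseteq> Ppos t}"
  note W = valid_Wset[OF st]
  have cpt: "compact (Omega ?W)"
    using closed_Omega[OF W(2)] compact_std_simplex Omega_simplex
    by (metis compact_Int_closed inf.absorb_iff2 subsetI)
  have stop: False if lc: "linear_constraints A0 A st x"
    and pos: "\<And>t. t \<in> Omega ?W \<Longrightarrow> 0 < t \<bullet> (pencil A0 A x *v t)" for x
  proof -
    obtain \<delta> where "0 < \<delta>" "\<forall>t\<in>Omega ?W. \<delta> \<le> t \<bullet> (pencil A0 A x *v t)"
      using positive_margin[OF cpt continuous_on_form, of "pencil A0 A x"] pos by blast
    then have "(x, - \<delta>) \<in> sip_feasible A0 A st" using lc by (simp add: sip_feasible_def)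
    then have "stop_at A0 A st" using \<open>0 < \<delta>\<close> by (force simp: stop_at_def)
    then show False using assms by simp
  qed
  have lcbar: "linear_constraints A0 A st xbar"
    by (rule valid_linear_constraints[OF st xbar])
  \<comment> \<open>Nonnegativity of \<open>y\<close> on \<open>F\<close> encodes the linear
    constraints: an inequality for every \<open>k\<close>, and the opposite one for \<open>k\<close>
    in \<open>Lset st i\<close>.\<close>
  define F where "F = (\<lambda>(i, k). coef A0 A (axis k 1) (tau st i)) ` (?I \<times> UNIV) \<union>
    (\<lambda>(i, k). coef A0 A (- axis k 1) (tau st i)) ` Sigma ?I (Lset st)"
  \<comment> \<open>A missing support means \<open>t $ k \<le> 0\<close> for some \<open>k\<close>
    in \<open>Ppos s\<close>: a closed condition, being a finite union.\<close>
  have "R = Omega ?W \<inter> (\<Inter>s\<in>?W. \<Union>k\<in>Ppos s. {t. t $ k \<le> 0})"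
    by (force simp: R_def Ppos_def not_less)
  moreover have "closed (\<Inter>s\<in>?W. \<Union>k\<in>Ppos s. {t :: real^'p. t $ k \<le> 0})"
    by (intro closed_INT ballI closed_UN closed_Collect_le continuous_intros) auto
  ultimately have "compact R" using cpt compact_Int_closed by metis
  then have C: "compact (?f ` R)" by (intro compact_continuous_image continuous_on_coef)
  have R: "t \<in> std_simplex" if "t \<in> R" for t
    using that unfolding R_def by (auto dest: Omega_simplex)
  have red: "0 < t \<bullet> (comb A0 A y *v t)" if "t \<in> Omega ?W"
    "\<And>s k. s \<in> ?W \<Longrightarrow> 0 \<le> (comb A0 A y *v s) $ k" "\<And>t. t \<in> R \<Longrightarrow> 0 < t \<bullet> (comb A0 A y *v t)" for y t
    using that(2,3) by (intro form_pos_on_Omega[OF W transpose_comb[OF sym] _ _ that(1)]) (auto simp: R_def)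
  \<comment> \<open>Were \<open>R\<close> empty, \<open>red\<close> at \<open>(1, xbar)\<close>
    would make the form positive on \<open>Omega ?W\<close>, and the iteration would stop.\<close>
  have Rne: "?f ` R \<noteq> {}"
  proof
    assume "?f ` R = {}"
    then show False
      using red[where y = "(1, xbar)"] linear_constraints_nonneg[OF lcbar]
      by (intro stop[OF lcbar]) (auto simp: comb_pencil)
  qed
  have F: "finite F"
    using st by (auto simp: F_def valid_state_def intro!: finite_SigmaI)
  have eC: "\<forall>c\<in>?f ` R. 0 \<le> (1, xbar) \<bullet> c"
    using feasX_nonneg[OF xbar] R by (auto simp: inner_coef_pencil)
  have eF: "\<forall>f\<in>F. 0 \<le> (1, xbar) \<bullet> f"
    using linear_constraints_nonneg[OF lcbar] lcbar
    by (auto simp: F_def inner_coef_pencil axis_inner Wset_def linear_constraints_def)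
  have ne: "(1::real, xbar) \<noteq> 0" by (simp add: zero_prod_def)
  show ?thesis
    using conic_alternative[OF C Rne F ne eC eF]
  proof (elim disjE exE conjE)
    fix y assume yC: "\<forall>c\<in>?f ` R. 0 < y \<bullet> c" and yF: "\<forall>f\<in>F. 0 \<le> y \<bullet> f"
    have ge: "0 \<le> (comb A0 A y *v tau st i) $ k" if "i \<in> ?I" for i k
    proof -
      have "coef A0 A (axis k 1) (tau st i) \<in> F" using that by (force simp: F_def)
      from yF[rule_format, OF this] show ?thesis by (simp add: inner_coef axis_inner)
    qed
    have eq: "(comb A0 A y *v tau st i) $ k = 0" if "i \<in> ?I" "k \<in> Lset st i" for i k
    proof -
      have "coef A0 A (- axis k 1) (tau st i) \<in> F" using that by (force simp: F_def)
      from yF[rule_format, OF this] show ?thesis using ge[OF that(1), of k] by (simp add: inner_coef axis_inner)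
    qed
    obtain x r s where r: "0 < r" "0 \<le> s" and x: "\<And>u v. r * (u \<bullet> (pencil A0 A x *v v)) =
        u \<bullet> (comb A0 A y *v v) + s * (u \<bullet> (pencil A0 A xbar *v v))"
      using normalise_direction[of A0 A y xbar] by blast
    have "0 < t \<bullet> (pencil A0 A x *v t)" if t: "t \<in> Omega ?W" for t
    proof -
      have "0 < t \<bullet> (comb A0 A y *v t)"
        using t by (rule red) (use ge yC in \<open>auto simp: Wset_def inner_coef\<close>)
      then have "0 < r * (t \<bullet> (pencil A0 A x *v t))"
        using r feasX_nonneg[OF xbar Omega_simplex[OF t]] by (simp add: x add_pos_nonneg)
      then show ?thesis using r(1) by (simp add: zero_less_mult_iff)
    qed
    \<comment> \<open>Both \<open>comb A0 A y\<close> and the pencil at \<open>xbar\<close> satisfy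
      the equalities and inequalities, hence so does their nonnegative combination.\<close>
    moreover have "linear_constraints A0 A st x"
      unfolding linear_constraints_def
    proof (intro ballI conjI)
      fix i k assume i: "i \<in> ?I" "k \<in> Lset st i"
      then have "axis k 1 \<bullet> (pencil A0 A xbar *v tau st i) = 0"
        using lcbar by (simp add: linear_constraints_def)
      then have "r * (axis k 1 \<bullet> (pencil A0 A x *v tau st i)) = 0"
        using x[of "axis k 1" "tau st i"] eq[OF i] axis_inner[of k "comb A0 A y *v tau st i"] by simp
      then show "axis k 1 \<bullet> (pencil A0 A x *v tau st i) = 0" using r(1) by simp
    next
      fix i k assume i: "i \<in> ?I"
      then have "0 \<le> (pencil A0 A xbar *v tau st i) $ k"
        using linear_constraints_nonneg[OF lcbar] by (simp add: Wset_def)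
      then have "0 \<le> r * (axis k 1 \<bullet> (pencil A0 A x *v tau st i))"
        using x[of "axis k 1" "tau st i"] ge[OF i, of k] r(2) by (simp add: axis_inner)
      then show "0 \<le> axis k 1 \<bullet> (pencil A0 A x *v tau st i)" using r(1) by (simp add: zero_le_mult_iff)
    qed
    ultimately show ?thesis using stop by blast
  next
    fix D u and v :: "real \<times> (real ^ 'n)"
    assume D: "finite D" "D \<subseteq> ?f ` R" "card D \<le> DIM(real \<times> (real ^ 'n))"
      "\<forall>d\<in>D. 0 < u d" "sum u D = 1" and v: "v \<in> convex_cone hull F" and Dv: "(\<Sum>d\<in>D. u d *\<^sub>R d) + v = 0"
    \<comment> \<open>All multiplier sums with admissible signs. This is a convex cone containing
      \<open>F\<close>, so \<open>v\<close> has such a representation.\<close>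
    define N where "N = {\<Sum>i\<in>?I. coef A0 A (\<Lambda> i) (tau st i) | \<Lambda>. \<forall>i\<in>?I. \<forall>k\<in>UNIV - Lset st i. 0 \<le> \<Lambda> i $ k}"
    have NI: "(\<Sum>i\<in>?I. coef A0 A (\<Lambda> i) (tau st i)) \<in> N"
      if "\<And>i k. i \<in> ?I \<Longrightarrow> k \<notin> Lset st i \<Longrightarrow> 0 \<le> \<Lambda> i $ k" for \<Lambda>
      using that by (auto simp: N_def)
    have "convex_cone N"
      unfolding convex_cone_iff
    proof (intro conjI ballI allI impI)
      show "0 \<in> N" using NI[of "\<lambda>_. 0"] by (simp add: coef_zero_left)
      fix a assume "a \<in> N"
      then obtain \<Lambda> where a: "a = (\<Sum>i\<in>?I. coef A0 A (\<Lambda> i) (tau st i))" "\<forall>i\<in>?I. \<forall>k\<in>UNIV - Lset st i. 0 \<le> \<Lambda> i $ k"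
        by (auto simp: N_def)
      show "c *\<^sub>R a \<in> N" if "0 \<le> c" for c
        using NI[of "\<lambda>i. c *\<^sub>R \<Lambda> i"] a that by (simp add: coef_scaleR_left scaleR_sum_right)
      fix b assume "b \<in> N"
      then obtain \<Lambda>' where b: "b = (\<Sum>i\<in>?I. coef A0 A (\<Lambda>' i) (tau st i))" "\<forall>i\<in>?I. \<forall>k\<in>UNIV - Lset st i. 0 \<le> \<Lambda>' i $ k"
        by (auto simp: N_def)
      show "a + b \<in> N"
        using NI[of "\<lambda>i. \<Lambda> i + \<Lambda>' i"] a b by (simp add: coef_add_left sum.distrib)
    qed
    moreover have "F \<subseteq> N"
    proof -
      \<comment> \<open>A multiplier family concentrated at the single label
        \<open>i\<close>.\<close>
      have gen: "coef A0 A w (tau st i) \<in> N"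
        if i: "i \<in> ?I" and w: "\<And>k. k \<notin> Lset st i \<Longrightarrow> 0 \<le> w $ k" for i w
      proof -
        have "(\<Sum>j\<in>?I. coef A0 A (if j = i then w else 0) (tau st j)) =
            (\<Sum>j\<in>?I. if j = i then coef A0 A w (tau st i) else 0)"
          by (intro sum.cong) (auto simp: coef_zero_left)
        also have "\<dots> = coef A0 A w (tau st i)"
          using i st by (simp add: valid_state_def)
        finally have eq: "(\<Sum>j\<in>?I. coef A0 A (if j = i then w else 0) (tau st j)) =
            coef A0 A w (tau st i)" .
        have "0 \<le> (if j = i then w else 0) $ k" if "j \<in> ?I" "k \<notin> Lset st j" for j k
          using w that by (cases "j = i") auto
        from NI[of "\<lambda>j. if j = i then w else 0", OF this] show ?thesis unfolding eq .
      qed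
      have "coef A0 A (axis k 1) (tau st i) \<in> N" if "i \<in> ?I" for i k
        by (rule gen[OF that]) (simp add: axis_def)
      moreover have "coef A0 A (- axis k 1) (tau st i) \<in> N" if "i \<in> ?I" "k \<in> Lset st i" for i k
        by (rule gen[OF that(1)]) (use that(2) in \<open>auto simp: axis_def\<close>)
      ultimately show ?thesis unfolding F_def by auto
    qed
    ultimately have "v \<in> N" using v hull_minimal[of F N convex_cone] by blast
    then obtain \<Lambda> where \<Lambda>: "v = (\<Sum>i\<in>?I. coef A0 A (\<Lambda> i) (tau st i))" "\<And>i k. i \<in> ?I \<Longrightarrow> k \<notin> Lset st i \<Longrightarrow> 0 \<le> \<Lambda> i $ k"
      by (auto simp: N_def)
    \<comment> \<open>The half cancels the factor 2 in the data equation.\<close>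
    let ?L = "\<lambda>i. (1 / 2) *\<^sub>R \<Lambda> i"
    have fin: "finite ?I" using st by (simp add: valid_state_def)
    obtain J :: "nat set" and \<tau> where J: "finite J" "J \<inter> ?I = {}" "card J = card D" "\<forall>i\<in>J. \<tau> i \<in> R"
      and bij: "bij_betw (\<lambda>i. ?f (\<tau> i)) J D"
      using label_points[OF D(1,2) fin] by blast
    have "2 *\<^sub>R (\<Sum>i\<in>?I. coef A0 A (?L i) (tau st i)) = v"
      unfolding \<Lambda>(1) by (simp add: coef_scaleR_left flip: scaleR_sum_right)
    then have "(\<Sum>i\<in>J. u (?f (\<tau> i)) *\<^sub>R ?f (\<tau> i)) + 2 *\<^sub>R (\<Sum>i\<in>?I. coef A0 A (?L i) (tau st i)) = 0"
      using sum.reindex_bij_betw[OF bij, of "\<lambda>d. u d *\<^sub>R d"] Dv by simp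
    then have "\<forall>M\<in>insert A0 (range A). (\<Sum>i\<in>J. u (?f (\<tau> i)) * (\<tau> i \<bullet> (M *v \<tau> i))) +
        2 * (\<Sum>i\<in>?I. ?L i \<bullet> (M *v tau st i)) = 0"
      unfolding data_equation_iff .
    moreover have "0 < card D" using D by (auto simp: card_gt_0_iff)
    moreover have "0 < u (?f (\<tau> i))" if "i \<in> J" for i
      using bij_betwE[OF bij] that D by blast
    moreover have "\<forall>i\<in>J. \<forall>j\<in>?I. Pzero (\<tau> i) \<inter> Ppos (tau st j) \<noteq> {}"
      using J(4) by (fastforce simp: R_def Pzero_def Wset_def)
    moreover have "\<forall>i\<in>J. \<tau> i \<in> Omega ?W" using J(4) by (simp add: R_def)
    ultimately have "iteration_data A0 A st J \<tau> (\<lambda>i. u (?f (\<tau> i))) ?L"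
      using J D(3) \<Lambda>(2) by (simp add: iteration_data_def)
    then show ?thesis by blast
  qed
qed

text \<open>Every iteration adds a point whose support contains none of the earlier supports, so the
  supports of these points are pairwise distinct subsets of the finite type \<open>'p\<close>.\<close>

lemma execution_terminates:
  fixes A0 :: "real ^ 'p ^ 'p" and A :: "'n::finite \<Rightarrow> real ^ 'p ^ 'p"
  assumes ex: "execution A0 A S"
  shows "\<exists>m. terminates_at A0 A S m"
proof (rule ccontr)
  assume contra: "\<nexists>m. terminates_at A0 A S m"
  have reached: "reached A0 A S m" for m
  proof (induction m)
    case (Suc m)
    then show ?case using contra ex by (auto simp: terminates_at_def execution_def)
  qed simp
  \<comment> \<open>The index is shifted because \<open>S 0\<close> carries no data.\<close>
  have step: "Wset (S (Suc m)) \<subseteq> Wset (S (Suc (Suc m))) \<and>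
      (\<exists>w\<in>Wset (S (Suc (Suc m))). \<forall>s\<in>Wset (S (Suc m)). \<not> Ppos s \<subseteq> Ppos w)" for m
  proof -
    have "iteration_result A0 A S (Suc m)" using reached[of "Suc (Suc m)"] by simp
    then obtain J \<tau> \<gamma> \<Lambda> where d: "iteration_data A0 A (S (Suc m)) J \<tau> \<gamma> \<Lambda>"
      and n: "S (Suc (Suc m)) = next_state (S (Suc m)) J \<tau> \<Lambda>"
      by (auto simp: iteration_result_def)
    have "J \<inter> idx (S (Suc m)) = {}" using d by (simp add: iteration_data_def)
    then have "Wset (S (Suc (Suc m))) = Wset (S (Suc m)) \<union> \<tau> ` J"
      by (force simp: n next_state_def Wset_def image_iff)
    moreover obtain j where "j \<in> J" using d by (force simp: iteration_data_def)
    moreover have "\<forall>s\<in>Wset (S (Suc m)). \<not> Ppos s \<subseteq> Ppos (\<tau> j)"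
      using d \<open>j \<in> J\<close> by (fastforce simp: iteration_data_def Wset_def Pzero_def)
    ultimately show ?thesis by blast
  qed
  then obtain w where w: "\<And>m. w m \<in> Wset (S (Suc (Suc m)))"
    "\<And>m s. s \<in> Wset (S (Suc m)) \<Longrightarrow> \<not> Ppos s \<subseteq> Ppos (w m)" by metis
  have mono: "Wset (S (Suc m)) \<subseteq> Wset (S (Suc k))" if "m \<le> k" for m k
    using lift_Suc_mono_le[of "\<lambda>m. Wset (S (Suc m))"] step that by blast
  \<comment> \<open>For \<open>m < k\<close>, \<open>w m\<close> is already an old point when
    \<open>w k\<close> is chosen, so its support is not contained in that of
    \<open>w k\<close>.\<close>
  have "Ppos (w m) \<noteq> Ppos (w k)" if "m < k" for m k
    using w mono[of "Suc m" k] that by (metis Suc_leI order_refl subsetD)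
  then have "inj (\<lambda>m. Ppos (w m))" by (intro linorder_injI) auto
  then show False using finite_imageD[of "\<lambda>m. Ppos (w m)" UNIV] by simp
qed

section \<open>Consequences of stopping\<close>

text \<open>Dividing by the coordinate sum transfers sign statements on the simplex to the orthant,
  as the form is homogeneous.\<close>

lemma orthant_cases:
  assumes "t \<in> nonneg_orthant" "t \<noteq> 0"
  obtains a s where "0 < a" "s \<in> std_simplex" "t = a *\<^sub>R s"
proof -
  define a where "a = (\<Sum>k\<in>UNIV. t $ k)"
  have nn: "\<And>k. 0 \<le> t $ k" using assms by (simp add: nonneg_orthant_def)
  have "a \<noteq> 0" using assms nn by (auto simp: a_def sum_nonneg_eq_0_iff vec_eq_iff)
  moreover have "0 \<le> a" using nn by (simp add: a_def sum_nonneg)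
  ultimately have a: "0 < a" by simp
  then have "(1 / a) *\<^sub>R t \<in> std_simplex"
    using nn by (simp add: std_simplex_def nonneg_orthant_def flip: sum_divide_distrib a_def)
  then show thesis using that[of a "(1 / a) *\<^sub>R t"] a by simp
qed

lemma stop_initial_slater:
  assumes "stop_initial A0 A"
  shows "slater_condition A0 A"
proof -
  obtain x \<mu> where "\<mu> < 0" and x: "\<And>t. t \<in> std_simplex \<Longrightarrow> 0 \<le> t \<bullet> (pencil A0 A x *v t) + \<mu>"
    using assms by (auto simp: stop_initial_def sip0_feasible_def)
  have "0 < t \<bullet> (pencil A0 A x *v t)" if t: "t \<in> nonneg_orthant - {0}" for t
  proof -
    obtain a s where a: "0 < a" "s \<in> std_simplex" "t = a *\<^sub>R s" using orthant_cases t by blast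
    then have "0 < s \<bullet> (pencil A0 A x *v s)" using x[OF a(2)] \<open>\<mu> < 0\<close> by simp
    then show ?thesis using a by (simp add: matrix_vector_mult_scaleR)
  qed
  then show ?thesis unfolding slater_condition_def by blast
qed

text \<open>The invariant gives one inclusion; the other is \<open>form_nonneg_on_simplex\<close>
  followed by scaling.\<close>

lemma regularized_feasible_set:
  assumes sym: "transpose A0 = A0" "\<And>i. transpose (A i) = A i" and st: "valid_state A0 A st"
  shows "x \<in> feasX A0 A \<longleftrightarrow>
    linear_constraints A0 A st x \<and> (\<forall>t\<in>Omega (Wset st). 0 \<le> t \<bullet> (pencil A0 A x *v t))"
proof
  assume "x \<in> feasX A0 A"
  then show "linear_constraints A0 A st x \<and> (\<forall>t\<in>Omega (Wset st). 0 \<le> t \<bullet> (pencil A0 A x *v t))"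
    using valid_linear_constraints[OF st] feasX_nonneg Omega_simplex by blast
next
  assume r: "linear_constraints A0 A st x \<and> (\<forall>t\<in>Omega (Wset st). 0 \<le> t \<bullet> (pencil A0 A x *v t))"
  have T: "0 \<le> t \<bullet> (pencil A0 A x *v t)" if "t \<in> std_simplex" for t
  proof (rule form_nonneg_on_simplex[OF valid_Wset[OF st] transpose_pencil[OF sym] _ _ that])
    show "0 \<le> (pencil A0 A x *v s) $ k" if "s \<in> Wset st" for s k
      using linear_constraints_nonneg r that by blast
    show "0 \<le> t \<bullet> (pencil A0 A x *v t)" if "t \<in> Omega (Wset st)" for t
      using r that by blast
  qed
  have "0 \<le> t \<bullet> (pencil A0 A x *v t)" if t: "t \<in> nonneg_orthant" for t
  proof (cases "t = 0")
    case False
    then obtain a s where a: "0 < a" "s \<in> std_simplex" "t = a *\<^sub>R s" using orthant_cases t by blast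
    then show ?thesis using T[OF a(2)] by (simp add: matrix_vector_mult_scaleR)
  qed simp
  then show "x \<in> feasX A0 A"
    using transpose_pencil[OF sym] by (simp add: feasX_def COP_def)
qed

theorem mainTheorem1:
  fixes c :: "real ^ 'n" and A0 :: "real ^ 'p ^ 'p" and A :: "'n \<Rightarrow> real ^ 'p ^ 'p"
  assumes "CARD('p) > 1"
    and "transpose A0 = A0"
    and "\<And>i. transpose (A i) = A i"
    and "feasX A0 A \<noteq> {}"
  shows
    "(\<not> stop_initial A0 A \<longrightarrow> (\<exists>I \<tau> \<gamma>. initial_data A0 A I \<tau> \<gamma>)) \<and>
     (\<forall>S. \<forall>m\<ge>1. reached A0 A S m \<longrightarrow>
        (\<not> stop_at A0 A (S m) \<longrightarrow> (\<exists>\<Delta>I \<tau> \<gamma> \<Lambda>. iteration_data A0 A (S m) \<Delta>I \<tau> \<gamma> \<Lambda>)) \<and>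
        (\<forall>i\<in>idx (S m).
           tau (S m) i \<in> immobile A0 A \<and>
           Ppos (tau (S m) i) \<subseteq> Lset (S m) i \<and> Lset (S m) i \<subseteq> UNIV \<and>
           (\<forall>k\<in>Lset (S m) i. \<forall>x\<in>feasX A0 A.
              axis k 1 \<bullet> (pencil A0 A x *v tau (S m) i) = 0))) \<and>
     (\<forall>S. execution A0 A S \<longrightarrow> (\<exists>m. terminates_at A0 A S m)) \<and>
     (\<forall>S. terminates_at A0 A S 0 \<longrightarrow> slater_condition A0 A) \<and>
     (\<forall>S. \<forall>m>0. terminates_at A0 A S m \<longrightarrow>
        equivalent_problems (regularized_problem c A0 A (S m)) (copositive_problem c A0 A) \<and>
        (\<exists>x\<in>feasX A0 A. \<forall>t\<in>Omega (Wset (S m)). t \<bullet> (pencil A0 A x *v t) > 0))"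
proof -
  note sym = assms(2,3)
  obtain xbar where xbar: "xbar \<in> feasX A0 A" using assms(4) by blast
  have valid: "valid_state A0 A (S m)" if "reached A0 A S m" "0 < m" for S m
    using valid_reached[OF that] .
  have i: "\<not> stop_initial A0 A \<longrightarrow> (\<exists>I \<tau> \<gamma>. initial_data A0 A I \<tau> \<gamma>)"
    using initial_data_exists[OF xbar] by blast
  have ii: "(\<not> stop_at A0 A (S m) \<longrightarrow> (\<exists>\<Delta>I \<tau> \<gamma> \<Lambda>. iteration_data A0 A (S m) \<Delta>I \<tau> \<gamma> \<Lambda>)) \<and>
      (\<forall>i\<in>idx (S m). tau (S m) i \<in> immobile A0 A \<and>
         Ppos (tau (S m) i) \<subseteq> Lset (S m) i \<and> Lset (S m) i \<subseteq> UNIV \<and>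
         (\<forall>k\<in>Lset (S m) i. \<forall>x\<in>feasX A0 A. axis k 1 \<bullet> (pencil A0 A x *v tau (S m) i) = 0))"
    if "1 \<le> m" "reached A0 A S m" for S m
    using iteration_data_exists[OF sym xbar valid[of S m]] valid[of S m] that
    unfolding axis_inner valid_state_def by simp
  have iv: "equivalent_problems (regularized_problem c A0 A (S m)) (copositive_problem c A0 A) \<and>
      (\<exists>x\<in>feasX A0 A. \<forall>t\<in>Omega (Wset (S m)). 0 < t \<bullet> (pencil A0 A x *v t))"
    if m: "0 < m" and T: "terminates_at A0 A S m" for S m
  proof
    have v: "valid_state A0 A (S m)" using valid m T by (simp add: terminates_at_def)
    note feas = regularized_feasible_set[OF sym v]
    show "equivalent_problems (regularized_problem c A0 A (S m)) (copositive_problem c A0 A)"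
      by (auto simp: equivalent_problems_def regularized_problem_def copositive_problem_def feas)
    have "stop_at A0 A (S m)" using T m by (simp add: terminates_at_def iteration_stops_def)
    then obtain x \<mu> where x: "linear_constraints A0 A (S m) x" "\<mu> < 0"
      "\<forall>t\<in>Omega (Wset (S m)). 0 \<le> t \<bullet> (pencil A0 A x *v t) + \<mu>"
      by (auto simp: stop_at_def sip_feasible_def)
    \<comment> \<open>As \<open>\<mu> < 0\<close>, the solution passing the test is strictly
      positive on \<open>Omega\<close>; it thus satisfies the regularized constraints and is
      feasible.\<close>
    then have pos: "\<forall>t\<in>Omega (Wset (S m)). 0 < t \<bullet> (pencil A0 A x *v t)" by fastforce
    then have "x \<in> feasX A0 A" unfolding feas using x(1) less_imp_le by blast
    with pos show "\<exists>x\<in>feasX A0 A. \<forall>t\<in>Omega (Wset (S m)). 0 < t \<bullet> (pencil A0 A x *v t)" by blast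
  qed
  have iii: "slater_condition A0 A" if "terminates_at A0 A S 0" for S
    using that stop_initial_slater by (simp add: terminates_at_def iteration_stops_def)
  show ?thesis
    using i ii execution_terminates[of A0 A] iii iv by simp
qed

end
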